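(* Let $A$ be a weak bialgebra with pre-antipode $S$. Then the following are equivalent: (i) $A$ is comonoidal and $S$ is anti-multiplicative; (ii) $A$ is monoidal and $S$ is anti-comultiplicative; (iii) $A$ is bimonoidal and $S$ is an antipode.
   Context: $K$ is a field and all spaces are finite dimensional over $K$. A weak bialgebra $(A,1,\Delta,\varepsilon)$ is a unital associative $K$-algebra $(A,1)$ which is also a coassociative coalgebra with coproduct $\Delta$ and counit $\varepsilon$, such that $\Delta(ab)=\Delta(a)\Delta(b)$ for all $a,b$; neither $\Delta(1)=1\otimes1$ nor multiplicativity of $\varepsilon$ is required. Sweedler notation is used. $A$ is monoidal if $\varepsilon(abc)=\varepsilon(ab_{(1)})\varepsilon(b_{(2)}c)=\varepsilon(ab_{(2)})\varepsilon(b_{(1)}c)$ for all $a,b,c\in A$; comonoidal if $(\Delta(1)\otimes1)(1\otimes\Delta(1))=1_{(1)}\otimes1_{(2)}\otimes1_{(3)}=(1\otimes\Delta(1))(\Delta(1)\otimes1)$; bimonoidal if it is monoidal and comonoidal. A pre-antipode on $A$ is a linear map $S:A\to A$ with $a_{(1)}S(a_{(2)})=\varepsilon(1_{(1)}a)1_{(2)}$ and $S(a_{(1)})a_{(2)}=1_{(1)}\varepsilon(a1_{(2)})$ for all $a\in A$. A pre-antipode is an antipode if in addition $S(a_{(1)})a_{(2)}S(a_{(3)})=S(a)$ for all $a\in A$. $S$ is anti-multiplicative if $S(ab)=S(b)S(a)$ for all $a,b$, and anti-comultiplicative if $\Delta(S(a))=S(a_{(2)})\otimes S(a_{(1)})$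 for all $a$. *)

theory Defs
  imports Complex_Main "HOL-Library.Function_Algebras"
begin

section \<open>Tensor powers of a vector space\<close>

text \<open>
  The tensor product is realised inside the dual of the space of bilinear (trilinear) forms:
  a pure tensor \<open>x \<otimes> y\<close> is the functional \<open>\<beta> \<mapsto> \<beta> x y\<close>, set to \<open>0\<close> at the arguments
  that are not bilinear, and the tensor square is the set of finite sums of pure tensors. All
  functionals live in one function type, whose pointwise addition comes from
  \<open>Function_Algebras\<close>. The theorems \<open>sweedler2_tens2_sum\<close> and \<open>sweedler3_tens3_sum\<close>
  below are the universal properties.
\<close>

type_synonym ('k, 'a) tensor2 = "('a \<Rightarrow> 'a \<Rightarrow> 'k) \<Rightarrow> 'k"
type_synonym ('k, 'a) tensor3 = "('a \<Rightarrow> 'a \<Rightarrow> 'a \<Rightarrow> 'k) \<Rightarrow> 'k"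

definition pointwise_scale :: "'k::field \<Rightarrow> ('b \<Rightarrow> 'k) \<Rightarrow> 'b \<Rightarrow> 'k"
  where "pointwise_scale c t = (\<lambda>\<beta>. c * t \<beta>)"

locale tensor_space = vector_space scale
  for scale :: "'k::field \<Rightarrow> 'a::ab_group_add \<Rightarrow> 'a" (infixr \<open>\<cdot>\<close> 75)
begin

definition bilinear_to :: "('k \<Rightarrow> 'v::ab_group_add \<Rightarrow> 'v) \<Rightarrow> ('a \<Rightarrow> 'a \<Rightarrow> 'v) \<Rightarrow> bool"
  where "bilinear_to s f \<longleftrightarrow>
    (\<forall>x. Vector_Spaces.linear scale s (\<lambda>y. f x y)) \<and>
    (\<forall>y. Vector_Spaces.linear scale s (\<lambda>x. f x y))"

definition trilinear_to :: "('k \<Rightarrow> 'v::ab_group_add \<Rightarrow> 'v) \<Rightarrow> ('a \<Rightarrow> 'a \<Rightarrow> 'a \<Rightarrow> 'v) \<Rightarrow> bool"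
  where "trilinear_to s f \<longleftrightarrow>
    (\<forall>x y. Vector_Spaces.linear scale s (\<lambda>z. f x y z)) \<and>
    (\<forall>x z. Vector_Spaces.linear scale s (\<lambda>y. f x y z)) \<and>
    (\<forall>y z. Vector_Spaces.linear scale s (\<lambda>x. f x y z))"

definition tens2 :: "'a \<Rightarrow> 'a \<Rightarrow> ('k, 'a) tensor2" (\<open>_ \<otimes> _\<close> [66, 66] 65)
  where "x \<otimes> y = (\<lambda>\<beta>. if bilinear_to (*) \<beta> then \<beta> x y else 0)"

definition tens3 :: "'a \<Rightarrow> 'a \<Rightarrow> 'a \<Rightarrow> ('k, 'a) tensor3" (\<open>_ \<otimes> _ \<otimes> _\<close> [66, 66, 66] 65)
  where "x \<otimes> y \<otimes> z = (\<lambda>\<tau>. if trilinear_to (*) \<tau> then \<tau> x y z else 0)"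

definition tensor_square :: "('k, 'a) tensor2 set"
  where "tensor_square = {\<Sum>(x, y)\<leftarrow>ps. x \<otimes> y | ps. True}"

text \<open>
  Sweedler summation: if \<open>t = t\<^sub>(\<^sub>1\<^sub>) \<otimes> t\<^sub>(\<^sub>2\<^sub>)\<close> (finite sum understood) then \<open>sweedler2 f t\<close> is
  the sum \<open>f t\<^sub>(\<^sub>1\<^sub>) t\<^sub>(\<^sub>2\<^sub>)\<close>. For bilinear \<open>f\<close> the value does not depend on the
  decomposition, and \<open>sweedler2 f\<close> is the linear map induced by \<open>f\<close>.
\<close>

definition sweedler2 :: "('a \<Rightarrow> 'a \<Rightarrow> 'v::ab_group_add) \<Rightarrow> ('k, 'a) tensor2 \<Rightarrow> 'v"
  where "sweedler2 f t =
    (THE v. \<exists>ps. t = (\<Sum>(x, y)\<leftarrow>ps. x \<otimes> y) \<and> v = (\<Sum>(x, y)\<leftarrow>ps. f x y))"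

definition sweedler3 :: "('a \<Rightarrow> 'a \<Rightarrow> 'a \<Rightarrow> 'v::ab_group_add) \<Rightarrow> ('k, 'a) tensor3 \<Rightarrow> 'v"
  where "sweedler3 f t =
    (THE v. \<exists>ps. t = (\<Sum>(x, y, z)\<leftarrow>ps. x \<otimes> y \<otimes> z) \<and> v = (\<Sum>(x, y, z)\<leftarrow>ps. f x y z))"

lemma separating_functional:
  assumes "vector_space (s :: 'k \<Rightarrow> 'v::ab_group_add \<Rightarrow> 'v)" and "v \<noteq> 0"
  obtains \<phi> where "Vector_Spaces.linear s (*) \<phi>" and "\<phi> v = 1"
proof -
  interpret V: vector_space s by fact
  interpret K: vector_space "(*) :: 'k \<Rightarrow> 'k \<Rightarrow> 'k"
    by (unfold_locales) (simp_all add: algebra_simps)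
  interpret VK: vector_space_pair s "(*) :: 'k \<Rightarrow> 'k \<Rightarrow> 'k" ..
  have "V.independent {v}" using assms(2) by simp
  from VK.linear_independent_extend[OF this, of "\<lambda>_. 1"] show ?thesis
    using that by auto
qed

lemma linear_compose_functional:
  assumes "Vector_Spaces.linear scale s g" "Vector_Spaces.linear s (*) \<phi>"
  shows "Vector_Spaces.linear scale (*) (\<lambda>x. \<phi> (g x))"
  using Vector_Spaces.linear_compose[OF assms] by (simp add: o_def)

lemma functional_sum_list:
  assumes "Vector_Spaces.linear s (*) \<phi>"
  shows "\<phi> (\<Sum>p\<leftarrow>ps. g p) = (\<Sum>p\<leftarrow>ps. \<phi> (g p))"
proof -
  interpret L: Vector_Spaces.linear s "(*)" \<phi> by fact
  show ?thesis by (induction ps) (simp_all add: L.zero L.add)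
qed

lemma sum_list_fun_apply:
  "(\<Sum>p\<leftarrow>ps. g p) \<beta> = (\<Sum>p\<leftarrow>ps. (g p \<beta> :: 'v::comm_monoid_add))"
  by (induction ps) simp_all

theorem sweedler2_tens2_sum:
  fixes f :: "'a \<Rightarrow> 'a \<Rightarrow> 'v::ab_group_add"
  assumes s: "vector_space s" and f: "bilinear_to s f"
  shows "sweedler2 f (\<Sum>(x, y)\<leftarrow>ps. x \<otimes> y) = (\<Sum>(x, y)\<leftarrow>ps. f x y)"
proof -
  have *: "(\<Sum>(x, y)\<leftarrow>qs. f x y) = (\<Sum>(x, y)\<leftarrow>ps. f x y)"
    if eq: "(\<Sum>(x, y)\<leftarrow>ps. x \<otimes> y) = (\<Sum>(x, y)\<leftarrow>qs. x \<otimes> y)" for qs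
  proof (rule ccontr)
    assume "\<not> ?thesis"
    then have "(\<Sum>(x, y)\<leftarrow>qs. f x y) - (\<Sum>(x, y)\<leftarrow>ps. f x y) \<noteq> 0" by simp
    from separating_functional[OF s this] obtain \<phi>
      where \<phi>: "Vector_Spaces.linear s (*) \<phi>"
        and one: "\<phi> ((\<Sum>(x, y)\<leftarrow>qs. f x y) - (\<Sum>(x, y)\<leftarrow>ps. f x y)) = 1" by blast
    interpret L: Vector_Spaces.linear s "(*)" \<phi> by fact
    let ?\<beta> = "\<lambda>x y. \<phi> (f x y)"
    have b: "bilinear_to (*) ?\<beta>"
      using f unfolding bilinear_to_def by (auto intro: linear_compose_functional[OF _ \<phi>])
    have ev: "(\<Sum>(x, y)\<leftarrow>rs. x \<otimes> y) ?\<beta> = \<phi> (\<Sum>(x, y)\<leftarrow>rs. f x y)" for rs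
      by (simp add: sum_list_fun_apply functional_sum_list[OF \<phi>] tens2_def b split_def)
    have "\<phi> (\<Sum>(x, y)\<leftarrow>qs. f x y) = \<phi> (\<Sum>(x, y)\<leftarrow>ps. f x y)"
      using eq ev by metis
    with one show False by (simp add: L.diff)
  qed
  show ?thesis
    unfolding sweedler2_def by (rule the_equality) (use * in blast)+
qed

theorem sweedler3_tens3_sum:
  fixes f :: "'a \<Rightarrow> 'a \<Rightarrow> 'a \<Rightarrow> 'v::ab_group_add"
  assumes s: "vector_space s" and f: "trilinear_to s f"
  shows "sweedler3 f (\<Sum>(x, y, z)\<leftarrow>ps. x \<otimes> y \<otimes> z) = (\<Sum>(x, y, z)\<leftarrow>ps. f x y z)"
proof -
  have *: "(\<Sum>(x, y, z)\<leftarrow>qs. f x y z) = (\<Sum>(x, y, z)\<leftarrow>ps. f x y z)"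
    if eq: "(\<Sum>(x, y, z)\<leftarrow>ps. x \<otimes> y \<otimes> z) = (\<Sum>(x, y, z)\<leftarrow>qs. x \<otimes> y \<otimes> z)" for qs
  proof (rule ccontr)
    assume "\<not> ?thesis"
    then have "(\<Sum>(x, y, z)\<leftarrow>qs. f x y z) - (\<Sum>(x, y, z)\<leftarrow>ps. f x y z) \<noteq> 0" by simp
    from separating_functional[OF s this] obtain \<phi>
      where \<phi>: "Vector_Spaces.linear s (*) \<phi>"
        and one: "\<phi> ((\<Sum>(x, y, z)\<leftarrow>qs. f x y z) - (\<Sum>(x, y, z)\<leftarrow>ps. f x y z)) = 1" by blast
    interpret L: Vector_Spaces.linear s "(*)" \<phi> by fact
    let ?\<tau> = "\<lambda>x y z. \<phi> (f x y z)"
    have t: "trilinear_to (*) ?\<tau>"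
      using f unfolding trilinear_to_def by (auto intro: linear_compose_functional[OF _ \<phi>])
    have ev: "(\<Sum>(x, y, z)\<leftarrow>rs. x \<otimes> y \<otimes> z) ?\<tau> = \<phi> (\<Sum>(x, y, z)\<leftarrow>rs. f x y z)" for rs
      by (simp add: sum_list_fun_apply functional_sum_list[OF \<phi>] tens3_def t split_def)
    have "\<phi> (\<Sum>(x, y, z)\<leftarrow>qs. f x y z) = \<phi> (\<Sum>(x, y, z)\<leftarrow>ps. f x y z)"
      using eq ev by metis
    with one show False by (simp add: L.diff)
  qed
  show ?thesis
    unfolding sweedler3_def by (rule the_equality) (use * in blast)+
qed

end

section \<open>Weak bialgebras\<close>

text \<open>
  Multiplication and unit are locale parameters rather than a type class, so that the zero
  algebra is not excluded.
\<close>

locale fin_dim_algebra = tensor_space scale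
  for scale :: "'k::field \<Rightarrow> 'a::ab_group_add \<Rightarrow> 'a" (infixr \<open>\<cdot>\<close> 75) +
  fixes mul :: "'a \<Rightarrow> 'a \<Rightarrow> 'a" (infixl \<open>\<odot>\<close> 70)
    and unit :: 'a (\<open>\<one>\<close>)
  assumes finite_dim: "\<exists>B. finite B \<and> span B = UNIV"
    and mul_bilinear: "bilinear_to scale (\<odot>)"
    and mul_assoc: "(a \<odot> b) \<odot> c = a \<odot> (b \<odot> c)"
    and unit_left: "\<one> \<odot> a = a"
    and unit_right: "a \<odot> \<one> = a"
begin

definition mul2 :: "('k, 'a) tensor2 \<Rightarrow> ('k, 'a) tensor2 \<Rightarrow> ('k, 'a) tensor2" (infixl \<open>\<odot>\<^sub>2\<close> 70)
  where "t \<odot>\<^sub>2 u = sweedler2 (\<lambda>x y. sweedler2 (\<lambda>x' y'. (x \<odot> x') \<otimes> (y \<odot> y')) u) t"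

definition mul3 :: "('k, 'a) tensor3 \<Rightarrow> ('k, 'a) tensor3 \<Rightarrow> ('k, 'a) tensor3" (infixl \<open>\<odot>\<^sub>3\<close> 70)
  where "t \<odot>\<^sub>3 u =
    sweedler3 (\<lambda>x y z. sweedler3 (\<lambda>x' y' z'. (x \<odot> x') \<otimes> (y \<odot> y') \<otimes> (z \<odot> z')) u) t"

definition tensor_unit_right :: "('k, 'a) tensor2 \<Rightarrow> ('k, 'a) tensor3" (\<open>_ \<otimes>\<one>\<close> [80] 80)
  where "t \<otimes>\<one> = sweedler2 (\<lambda>x y. x \<otimes> y \<otimes> \<one>) t"

definition tensor_unit_left :: "('k, 'a) tensor2 \<Rightarrow> ('k, 'a) tensor3" (\<open>\<one>\<otimes> _\<close> [80] 80)
  where "\<one>\<otimes> t = sweedler2 (\<lambda>x y. \<one> \<otimes> x \<otimes> y) t"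

definition anti_multiplicative :: "('a \<Rightarrow> 'a) \<Rightarrow> bool"
  where "anti_multiplicative S \<longleftrightarrow> (\<forall>a b. S (a \<odot> b) = S b \<odot> S a)"

end

locale coproduct_space = tensor_space scale
  for scale :: "'k::field \<Rightarrow> 'a::ab_group_add \<Rightarrow> 'a" (infixr \<open>\<cdot>\<close> 75) +
  fixes comul :: "'a \<Rightarrow> ('k, 'a) tensor2" (\<open>\<Delta>\<close>)
  assumes comul_linear: "Vector_Spaces.linear scale pointwise_scale \<Delta>"
    and comul_tensor: "\<Delta> a \<in> tensor_square"
begin

definition comul_id :: "('k, 'a) tensor2 \<Rightarrow> ('k, 'a) tensor3"
  where "comul_id t = sweedler2 (\<lambda>x z. sweedler2 (\<lambda>u v. u \<otimes> v \<otimes> z) (\<Delta> x)) t"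

definition id_comul :: "('k, 'a) tensor2 \<Rightarrow> ('k, 'a) tensor3"
  where "id_comul t = sweedler2 (\<lambda>x z. sweedler2 (\<lambda>u v. x \<otimes> u \<otimes> v) (\<Delta> z)) t"

text \<open>\<open>\<Delta>\<^sub>3 a\<close> is \<open>a\<^sub>(\<^sub>1\<^sub>) \<otimes> a\<^sub>(\<^sub>2\<^sub>) \<otimes> a\<^sub>(\<^sub>3\<^sub>)\<close> in Sweedler notation.\<close>

definition comul3 :: "'a \<Rightarrow> ('k, 'a) tensor3" (\<open>\<Delta>\<^sub>3\<close>)
  where "\<Delta>\<^sub>3 a = comul_id (\<Delta> a)"

definition anti_comultiplicative :: "('a \<Rightarrow> 'a) \<Rightarrow> bool"
  where "anti_comultiplicative S \<longleftrightarrow> (\<forall>a. \<Delta> (S a) = sweedler2 (\<lambda>x y. S y \<otimes> S x) (\<Delta> a))"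

end

locale coalgebra = coproduct_space scale comul
  for scale :: "'k::field \<Rightarrow> 'a::ab_group_add \<Rightarrow> 'a" (infixr \<open>\<cdot>\<close> 75)
    and comul :: "'a \<Rightarrow> ('k, 'a) tensor2" (\<open>\<Delta>\<close>) +
  fixes counit :: "'a \<Rightarrow> 'k" (\<open>\<epsilon>\<close>)
  assumes counit_linear: "Vector_Spaces.linear scale (*) \<epsilon>"
    and coassoc: "comul_id (\<Delta> a) = id_comul (\<Delta> a)"
    and counit_left: "sweedler2 (\<lambda>x y. \<epsilon> x \<cdot> y) (\<Delta> a) = a"
    and counit_right: "sweedler2 (\<lambda>x y. \<epsilon> y \<cdot> x) (\<Delta> a) = a"

locale weak_bialgebra = fin_dim_algebra scale mul unit + coalgebra scale comul counit
  for scale :: "'k::field \<Rightarrow> 'a::ab_group_add \<Rightarrow> 'a" (infixr \<open>\<cdot>\<close> 75)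
    and mul :: "'a \<Rightarrow> 'a \<Rightarrow> 'a" (infixl \<open>\<odot>\<close> 70)
    and unit :: 'a (\<open>\<one>\<close>)
    and comul :: "'a \<Rightarrow> ('k, 'a) tensor2" (\<open>\<Delta>\<close>)
    and counit :: "'a \<Rightarrow> 'k" (\<open>\<epsilon>\<close>) +
  assumes comul_mul: "\<Delta> (a \<odot> b) = \<Delta> a \<odot>\<^sub>2 \<Delta> b"
begin

definition monoidal :: bool
  where "monoidal \<longleftrightarrow> (\<forall>a b c.
    \<epsilon> (a \<odot> b \<odot> c) = sweedler2 (\<lambda>b1 b2. \<epsilon> (a \<odot> b1) * \<epsilon> (b2 \<odot> c)) (\<Delta> b) \<and>
    \<epsilon> (a \<odot> b \<odot> c) = sweedler2 (\<lambda>b1 b2. \<epsilon> (a \<odot> b2) * \<epsilon> (b1 \<odot> c)) (\<Delta> b))"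

definition comonoidal :: bool
  where "comonoidal \<longleftrightarrow>
    (\<Delta> \<one> \<otimes>\<one>) \<odot>\<^sub>3 (\<one>\<otimes> \<Delta> \<one>) = \<Delta>\<^sub>3 \<one> \<and>
    \<Delta>\<^sub>3 \<one> = (\<one>\<otimes> \<Delta> \<one>) \<odot>\<^sub>3 (\<Delta> \<one> \<otimes>\<one>)"

definition bimonoidal :: bool
  where "bimonoidal \<longleftrightarrow> monoidal \<and> comonoidal"

definition pre_antipode :: "('a \<Rightarrow> 'a) \<Rightarrow> bool"
  where "pre_antipode S \<longleftrightarrow> Vector_Spaces.linear scale scale S \<and> (\<forall>a.
    sweedler2 (\<lambda>a1 a2. a1 \<odot> S a2) (\<Delta> a) = sweedler2 (\<lambda>e1 e2. \<epsilon> (e1 \<odot> a) \<cdot> e2) (\<Delta> \<one>) \<and>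
    sweedler2 (\<lambda>a1 a2. S a1 \<odot> a2) (\<Delta> a) = sweedler2 (\<lambda>e1 e2. \<epsilon> (a \<odot> e2) \<cdot> e1) (\<Delta> \<one>))"

definition antipode :: "('a \<Rightarrow> 'a) \<Rightarrow> bool"
  where "antipode S \<longleftrightarrow> pre_antipode S \<and>
    (\<forall>a. sweedler3 (\<lambda>a1 a2 a3. S a1 \<odot> a2 \<odot> S a3) (\<Delta>\<^sub>3 a) = S a)"

end

end

theory Submission
  imports Defs
begin

text \<open>
  Write \<open>E a = \<epsilon>(1\<^sub>(\<^sub>1\<^sub>)a)1\<^sub>(\<^sub>2\<^sub>)\<close> and \<open>F a = 1\<^sub>(\<^sub>1\<^sub>)\<epsilon>(a1\<^sub>(\<^sub>2\<^sub>))\<close>, and let \<open>A\<close> be comonoidal. Then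
  \<open>\<Delta>(a E(b)) = a\<^sub>(\<^sub>1\<^sub>)E(b) \<otimes> a\<^sub>(\<^sub>2\<^sub>)\<close>, similarly for \<open>F\<close>, and the ranges of \<open>E\<close> and \<open>F\<close> commute.

  If \<open>S\<close> is anti-multiplicative, then \<open>E(ab) = a\<^sub>(\<^sub>1\<^sub>)E(b)S(a\<^sub>(\<^sub>2\<^sub>)) = E(a E(b))\<close>, hence
  \<open>\<epsilon>(ab) = \<epsilon>(a E(b))\<close>, which is half of monoidality. Moreover \<open>S\<close> agrees with \<open>F\<close> on the range
  of \<open>E\<close> and with \<open>E\<close> on the range of \<open>F\<close>; it is injective there, so by finite dimension every \<open>E(c)\<close>
  is \<open>S(x)\<close> with \<open>x\<close> in the range of \<open>F\<close>, and \<open>\<epsilon>(bc) = \<epsilon>(bx)\<close> gives the other half. The antipode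
  law is \<open>S(a\<^sub>(\<^sub>1\<^sub>))E(a\<^sub>(\<^sub>2\<^sub>)) = S(1\<^sub>(\<^sub>1\<^sub>)a)1\<^sub>(\<^sub>2\<^sub>) = S(a)\<close>. Conversely, for a bimonoidal \<open>A\<close> with antipode,
  \<open>S(ab) = S(a\<^sub>(\<^sub>1\<^sub>)b\<^sub>(\<^sub>1\<^sub>))E(a\<^sub>(\<^sub>2\<^sub>)b\<^sub>(\<^sub>2\<^sub>)) = F(a\<^sub>(\<^sub>1\<^sub>)b\<^sub>(\<^sub>1\<^sub>))S(b\<^sub>(\<^sub>2\<^sub>))S(a\<^sub>(\<^sub>2\<^sub>)) = S(b)S(a)\<close>.

  This is (i) \<open>\<longleftrightarrow>\<close> (iii). The equivalence (ii) \<open>\<longleftrightarrow>\<close> (iii) is the same statement for the dual weak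
  bialgebra.
\<close>

section \<open>Multilinear maps and Sweedler sums\<close>

abbreviation (input) lin where "lin \<equiv> Vector_Spaces.linear"

section \<open>Linear maps between arbitrary spaces\<close>

lemma sum_list_commute:
  "(\<Sum>x\<leftarrow>xs. \<Sum>y\<leftarrow>ys. f x y) = (\<Sum>y\<leftarrow>ys. \<Sum>x\<leftarrow>xs. (f x y :: 'v::comm_monoid_add))"
  by (induction xs) (simp_all add: sum_list_addf)

lemma sum_fun_apply: "(\<Sum>i\<in>I. g i) \<beta> = (\<Sum>i\<in>I. (g i \<beta> :: 'v::comm_monoid_add))"
  by (induction I rule: infinite_finite_induct) simp_all

lemma linear_sum_list:
  assumes "lin s t h"
  shows "h (\<Sum>p\<leftarrow>ps. g p) = (\<Sum>p\<leftarrow>ps. h (g p))"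
proof -
  interpret L: Vector_Spaces.linear s t h by fact
  show ?thesis by (induction ps) (simp_all add: L.zero L.add)
qed

lemma vector_space_mult: "vector_space ((*) :: 'k::field \<Rightarrow> 'k \<Rightarrow> 'k)"
  by unfold_locales (simp_all add: algebra_simps)

lemma vector_space_pointwise: "vector_space (pointwise_scale :: 'k::field \<Rightarrow> ('b \<Rightarrow> 'k) \<Rightarrow> 'b \<Rightarrow> 'k)"
  by unfold_locales (simp_all add: pointwise_scale_def fun_eq_iff algebra_simps)

text \<open>Addition and scaling of functionals are pointwise, so linearity can be tested at each
  argument. Maps into tensor powers are handled this way.\<close>

lemma linear_pointwise_iff:
  "lin s pointwise_scale g \<longleftrightarrow> vector_space s \<and> (\<forall>\<beta>. lin s (*) (\<lambda>a. g a \<beta>))"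
  by (auto simp: Vector_Spaces.linear_iff vector_space_mult vector_space_pointwise pointwise_scale_def fun_eq_iff)

lemma linear_zero: "vector_space s \<Longrightarrow> vector_space t \<Longrightarrow> lin s t (\<lambda>x. 0)"
  by (auto simp: Vector_Spaces.linear_iff module_iff_vector_space[symmetric] module.scale_zero_right)

lemma linear_if:
  "(P \<Longrightarrow> lin s t f) \<Longrightarrow> (\<not> P \<Longrightarrow> lin s t g) \<Longrightarrow> lin s t (\<lambda>x. if P then f x else g x)"
  by (cases P) simp_all

lemma linear_target: "lin s t h \<Longrightarrow> vector_space t"
  by (simp add: Vector_Spaces.linear_iff)

lemma linear_comp: "lin t u h \<Longrightarrow> lin s t g \<Longrightarrow> lin s u (\<lambda>x. h (g x))"
  by (simp add: Vector_Spaces.linear_iff)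

lemma linear_scale_const: "lin s t g \<Longrightarrow> lin s t (\<lambda>x. t c (g x))"
  by (simp add: Vector_Spaces.linear_iff vector_space_def mult.commute)

lemma linear_scale_vector: "vector_space t \<Longrightarrow> lin s (*) g \<Longrightarrow> lin s t (\<lambda>x. t (g x) v)"
  by (simp add: Vector_Spaces.linear_iff vector_space_def)

lemma linear_sum_list_fun:
  assumes "vector_space s" "vector_space t" "\<And>p. lin s t (\<lambda>x. g p x)"
  shows "lin s t (\<lambda>x. \<Sum>p\<leftarrow>ps. g p x)"
proof -
  have *: "t c 0 = 0" for c
    using assms(2) by (metis module.scale_zero_right module_iff_vector_space)
  have **: "t c (x + y) = t c x + t c y" for c x y
    using assms(2) by (simp add: vector_space_def)
  show ?thesis
    using assms by (induction ps) (auto simp: Vector_Spaces.linear_iff * ** algebra_simps)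
qed

text \<open>Introduction rules stated with a linear map substituted for one argument. Repeated use
  of them proves multilinearity of expressions composed from the structure maps.\<close>

named_theorems multilinear

section \<open>Multilinearity and evaluation of tensors\<close>

context tensor_space
begin

lemma vector_space_scale: "vector_space scale"
  by unfold_locales

lemmas linear_scale_const_mult [multilinear] = linear_scale_const[where t = "(*)"]
lemmas linear_scale_const_scale [multilinear] = linear_scale_const[where t = scale]
lemmas linear_scale_vector_mult [multilinear] = linear_scale_vector[OF vector_space_mult]
lemmas linear_scale_vector_scale [multilinear] = linear_scale_vector[OF vector_space_scale]

lemma linear_id [multilinear]: "lin scale scale (\<lambda>x. x)"
  by (simp add: Vector_Spaces.linear_iff vector_space_scale)

lemma linear_scale_apply: "lin scale s g \<Longrightarrow> g (c \<cdot> x) = s c (g x)"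
  by (simp add: Vector_Spaces.linear_iff)

lemma bilinear_toI [multilinear]:
  assumes "\<And>x. lin scale s (\<lambda>y. f x y)" "\<And>y. lin scale s (\<lambda>x. f x y)"
  shows "bilinear_to s f"
  using assms by (simp add: bilinear_to_def)

lemma trilinear_toI [multilinear]:
  assumes "\<And>x y. lin scale s (\<lambda>z. f x y z)" "\<And>x z. lin scale s (\<lambda>y. f x y z)"
    "\<And>y z. lin scale s (\<lambda>x. f x y z)"
  shows "trilinear_to s f"
  using assms by (simp add: trilinear_to_def)

lemma bilinear_to_left: "bilinear_to s f \<Longrightarrow> lin r scale g \<Longrightarrow> lin r s (\<lambda>x. f (g x) y)"
  using linear_comp[of scale s "\<lambda>x. f x y"] by (simp add: bilinear_to_def)

lemma bilinear_to_right: "bilinear_to s f \<Longrightarrow> lin r scale g \<Longrightarrow> lin r s (\<lambda>y. f x (g y))"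
  using linear_comp[of scale s "\<lambda>y. f x y"] by (simp add: bilinear_to_def)

lemma bilinear_to_target: "bilinear_to s f \<Longrightarrow> vector_space s"
  by (auto simp: bilinear_to_def dest: linear_target)

lemma trilinear_to_first: "trilinear_to s f \<Longrightarrow> lin r scale g \<Longrightarrow> lin r s (\<lambda>x. f (g x) y z)"
  using linear_comp[of scale s "\<lambda>x. f x y z"] by (simp add: trilinear_to_def)

lemma trilinear_to_second: "trilinear_to s f \<Longrightarrow> lin r scale g \<Longrightarrow> lin r s (\<lambda>y. f x (g y) z)"
  using linear_comp[of scale s "\<lambda>y. f x y z"] by (simp add: trilinear_to_def)

lemma trilinear_to_third: "trilinear_to s f \<Longrightarrow> lin r scale g \<Longrightarrow> lin r s (\<lambda>z. f x y (g z))"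
  using linear_comp[of scale s "\<lambda>z. f x y z"] by (simp add: trilinear_to_def)

lemma trilinear_to_target: "trilinear_to s f \<Longrightarrow> vector_space s"
  by (auto simp: trilinear_to_def dest: linear_target)

lemmas bilinear_to_comp = bilinear_to_left bilinear_to_right
lemmas trilinear_to_comp = trilinear_to_first trilinear_to_second trilinear_to_third

text \<open>Linear functionals separate points, so identities in an arbitrary target reduce to
  scalar ones. For these a tensor can simply be evaluated, being itself a functional on
  forms.\<close>

lemma eq_by_functionals:
  fixes v w :: "'v::ab_group_add"
  assumes "vector_space (s :: 'k \<Rightarrow> 'v \<Rightarrow> 'v)" "\<And>\<phi>. lin s (*) \<phi> \<Longrightarrow> \<phi> v = \<phi> w"
  shows "v = w"
proof (rule ccontr)
  assume "v \<noteq> w"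
  then have "v - w \<noteq> 0" by simp
  from separating_functional[OF assms(1) this] obtain \<phi> where \<phi>: "lin s (*) \<phi>" "\<phi> (v - w) = 1"
    by blast
  interpret L: Vector_Spaces.linear s "(*)" \<phi> by fact
  from \<phi> assms(2)[OF \<phi>(1)] show False by (simp add: L.diff)
qed

text \<open>At a bilinear argument a pure tensor is linear in each factor; at every other argument
  it is constantly 0, which is linear as well.\<close>

lemma tens2_linear [multilinear]:
  "lin scale scale g \<Longrightarrow> lin scale pointwise_scale (\<lambda>x. tens2 (g x) y)"
  "lin scale scale g \<Longrightarrow> lin scale pointwise_scale (\<lambda>x. tens2 y (g x))"
  by (auto simp: linear_pointwise_iff tens2_def vector_space_scale
      vector_space_mult intro!: linear_if linear_zero intro: bilinear_to_comp)

lemma tens3_linear [multilinear]: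
  "lin scale scale g \<Longrightarrow> lin scale pointwise_scale (\<lambda>x. tens3 (g x) y z)"
  "lin scale scale g \<Longrightarrow> lin scale pointwise_scale (\<lambda>x. tens3 y (g x) z)"
  "lin scale scale g \<Longrightarrow> lin scale pointwise_scale (\<lambda>x. tens3 y z (g x))"
  by (auto simp: linear_pointwise_iff tens3_def vector_space_scale
      vector_space_mult intro!: linear_if linear_zero intro: trilinear_to_comp)

definition tensor_cube :: "('k, 'a) tensor3 set"
  where "tensor_cube = {\<Sum>(x, y, z)\<leftarrow>ps. x \<otimes> y \<otimes> z | ps. True}"

lemma tensor_square_add: "t \<in> tensor_square \<Longrightarrow> u \<in> tensor_square \<Longrightarrow> t + u \<in> tensor_square"
  unfolding tensor_square_def
  by (auto simp flip: sum_list_append map_append)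

lemma tensor_cube_add: "t \<in> tensor_cube \<Longrightarrow> u \<in> tensor_cube \<Longrightarrow> t + u \<in> tensor_cube"
  unfolding tensor_cube_def
  by (auto simp flip: sum_list_append map_append)

lemma tensor_square_sum_list:
  "(\<And>p. g p \<in> tensor_square) \<Longrightarrow> (\<Sum>p\<leftarrow>ps. g p) \<in> tensor_square"
proof (induction ps)
  case Nil
  show ?case unfolding tensor_square_def by (auto intro!: exI[of _ "[]"] simp: zero_fun_def)
qed (simp add: tensor_square_add)

lemma tensor_square_sum:
  assumes "\<And>i. g i \<in> tensor_square"
  shows "(\<Sum>i\<in>I. g i) \<in> tensor_square"
proof -
  have "(0 :: ('k, 'a) tensor2) \<in> tensor_square"
    unfolding tensor_square_def by (auto intro!: exI[of _ "[]"] simp: zero_fun_def)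
  then show ?thesis
    by (induction I rule: infinite_finite_induct) (simp_all add: assms tensor_square_add)
qed

lemma tensor_cube_sum_list:
  "(\<And>p. g p \<in> tensor_cube) \<Longrightarrow> (\<Sum>p\<leftarrow>ps. g p) \<in> tensor_cube"
proof (induction ps)
  case Nil
  show ?case unfolding tensor_cube_def by (auto intro!: exI[of _ "[]"] simp: zero_fun_def)
qed (simp add: tensor_cube_add)

lemma tens2_in_square: "x \<otimes> y \<in> tensor_square"
  unfolding tensor_square_def by (auto intro: exI[of _ "[(x, y)]"])

lemma tens3_in_cube: "x \<otimes> y \<otimes> z \<in> tensor_cube"
  unfolding tensor_cube_def by (auto intro: exI[of _ "[(x, y, z)]"])

text \<open>Replaces the \<open>THE\<close> in the Sweedler sum by evaluation of \<open>t\<close> at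
  the scalar form obtained by composing \<open>f\<close> with \<open>\<phi>\<close>.\<close>

lemma sweedler3_functional:
  assumes "t \<in> tensor_cube" "trilinear_to s f" "lin s (*) \<phi>"
  shows "\<phi> (sweedler3 f t) = t (\<lambda>x y z. \<phi> (f x y z))"
proof -
  obtain ps where t: "t = (\<Sum>(x, y, z)\<leftarrow>ps. x \<otimes> y \<otimes> z)"
    using assms(1) by (auto simp: tensor_cube_def)
  have "trilinear_to (*) (\<lambda>x y z. \<phi> (f x y z))"
    using assms(2) by (intro multilinear linear_comp[OF assms(3)] trilinear_to_comp[OF assms(2)])
  then show ?thesis
    unfolding t sweedler3_tens3_sum[OF trilinear_to_target[OF assms(2)] assms(2)]
    by (simp add: linear_sum_list[OF assms(3)] sum_list_fun_apply tens3_def split_def)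
qed

text \<open>Pure tensors are 0 at such arguments by convention. Hence tensors need to be compared at
  multilinear forms only.\<close>

lemma tensor_cube_not_trilinear:
  assumes "t \<in> tensor_cube" "\<not> trilinear_to (*) \<tau>"
  shows "t \<tau> = 0"
  using assms by (auto simp: tensor_cube_def sum_list_fun_apply tens3_def split_def)

lemma tensor_square_not_bilinear:
  assumes "t \<in> tensor_square" "\<not> bilinear_to (*) \<beta>"
  shows "t \<beta> = 0"
  using assms by (auto simp: tensor_square_def sum_list_fun_apply tens2_def split_def)

end

section \<open>Sums over a fixed decomposition of the coproduct\<close>

context coproduct_space
begin

definition coproduct_list :: "'a \<Rightarrow> ('a \<times> 'a) list"
  where "coproduct_list a = (SOME ps. \<Delta> a = (\<Sum>(x, y)\<leftarrow>ps. x \<otimes> y))"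

text \<open>
  Summing over a fixed decomposition of \<open>\<Delta> a\<close> makes sense for every \<open>f\<close>, so that, unlike for
  \<open>sweedler2\<close>, nested sums can be swapped and linear maps moved inside without multilinearity
  conditions.
\<close>

definition cosum :: "('a \<Rightarrow> 'a \<Rightarrow> 'v::ab_group_add) \<Rightarrow> 'a \<Rightarrow> 'v"
  where "cosum f a = (\<Sum>(x, y)\<leftarrow>coproduct_list a. f x y)"

lemma comul_eq_list: "\<Delta> a = (\<Sum>(x, y)\<leftarrow>coproduct_list a. x \<otimes> y)"
  using someI_ex[of "\<lambda>ps. \<Delta> a = (\<Sum>(x, y)\<leftarrow>ps. x \<otimes> y)"] comul_tensor[of a]
  unfolding coproduct_list_def tensor_square_def by blast

text \<open>By the universal property the sum of a bilinear \<open>f\<close> is independent of the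
  decomposition, so the chosen one may be used.\<close>

lemma sweedler2_comul: "bilinear_to s f \<Longrightarrow> sweedler2 f (\<Delta> a) = cosum f a"
  unfolding comul_eq_list[of a] cosum_def
  by (intro sweedler2_tens2_sum[of s] bilinear_to_target[of s])

lemma comul_apply: "bilinear_to (*) \<beta> \<Longrightarrow> \<Delta> a \<beta> = cosum \<beta> a"
  by (subst comul_eq_list) (simp add: cosum_def sum_list_fun_apply tens2_def split_def)

lemma linear_cosum: "lin s t h \<Longrightarrow> h (cosum f a) = cosum (\<lambda>x y. h (f x y)) a"
  unfolding cosum_def by (simp add: linear_sum_list split_def)

lemma cosum_apply: "cosum g a \<beta> = cosum (\<lambda>x y. g x y \<beta>) a"
  unfolding cosum_def by (simp add: sum_list_fun_apply split_def)

lemma cosum_swap: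
  "cosum (\<lambda>x y. cosum (\<lambda>u v. f x y u v) b) a = cosum (\<lambda>u v. cosum (\<lambda>x y. f x y u v) a) b"
  unfolding cosum_def split_def by (rule sum_list_commute)

lemma cosum_in_cube: "(\<And>x y. g x y \<in> tensor_cube) \<Longrightarrow> cosum g a \<in> tensor_cube"
  unfolding cosum_def split_def by (rule tensor_cube_sum_list)

lemma cosum_in_square: "(\<And>x y. g x y \<in> tensor_square) \<Longrightarrow> cosum g a \<in> tensor_square"
  unfolding cosum_def split_def by (rule tensor_square_sum_list)

lemma linear_cosum_fun:
  assumes "vector_space s" "vector_space t" "\<And>x y. lin s t (\<lambda>a. f a x y)"
  shows "lin s t (\<lambda>a. cosum (f a) b)"
  unfolding cosum_def split_def using assms by (intro linear_sum_list_fun)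

lemma linear_cosum_fun_scale [multilinear]:
  assumes "\<And>x y. lin scale t (\<lambda>a. f a x y)"
  shows "lin scale t (\<lambda>a. cosum (f a) b)"
  using assms linear_target[OF assms] by (intro linear_cosum_fun vector_space_scale)

text \<open>The chosen list need not depend linearly on \<open>a\<close>. A functional applied to
  the sum, however, gives the value of \<open>\<Delta> a\<close> at a bilinear form, and
  \<open>\<Delta>\<close> is linear.\<close>

lemma linear_cosum_arg:
  assumes "bilinear_to s f"
  shows "lin scale s (cosum f)"
proof -
  have s: "vector_space s" using assms by (rule bilinear_to_target)
  have \<phi>: "\<phi> (cosum f a) = \<Delta> a (\<lambda>x y. \<phi> (f x y))" if "lin s (*) \<phi>" for \<phi> a
    using that assms
    by (simp add: linear_cosum comul_apply multilinear linear_comp[OF that] bilinear_to_comp[OF assms])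
  show ?thesis
    unfolding Vector_Spaces.linear_iff
  proof (intro conjI allI vector_space_scale s)
    fix x y
    show "cosum f (x + y) = cosum f x + cosum f y"
    proof (rule eq_by_functionals[OF s])
      fix \<phi> assume l: "lin s (*) \<phi>"
      then show "\<phi> (cosum f (x + y)) = \<phi> (cosum f x + cosum f y)"
        using comul_linear by (simp add: \<phi> Vector_Spaces.linear_iff)
    qed
  next
    fix c x
    show "cosum f (c \<cdot> x) = s c (cosum f x)"
    proof (rule eq_by_functionals[OF s])
      fix \<phi> assume l: "lin s (*) \<phi>"
      then show "\<phi> (cosum f (c \<cdot> x)) = \<phi> (s c (cosum f x))"
        using comul_linear by (simp add: \<phi> Vector_Spaces.linear_iff pointwise_scale_def)
    qed
  qed
qed

lemma linear_cosum_arg_comp [multilinear]: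
  assumes "bilinear_to s f" "lin scale scale g"
  shows "lin scale s (\<lambda>a. cosum f (g a))"
  using linear_comp[OF linear_cosum_arg[OF assms(1)] assms(2)] .

lemma comul_id_eq: "comul_id (\<Delta> a) = cosum (\<lambda>x z. cosum (\<lambda>u v. u \<otimes> v \<otimes> z) x) a"
proof -
  have "sweedler2 (\<lambda>u v. u \<otimes> v \<otimes> z) (\<Delta> x) = cosum (\<lambda>u v. u \<otimes> v \<otimes> z) x" for x z
    by (rule sweedler2_comul[of pointwise_scale]) (intro multilinear)
  then show ?thesis
    unfolding comul_id_def by (subst sweedler2_comul[of pointwise_scale]) (auto intro!: multilinear)
qed

lemma id_comul_eq: "id_comul (\<Delta> a) = cosum (\<lambda>x z. cosum (\<lambda>u v. x \<otimes> u \<otimes> v) z) a"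
proof -
  have "sweedler2 (\<lambda>u v. x \<otimes> u \<otimes> v) (\<Delta> z) = cosum (\<lambda>u v. x \<otimes> u \<otimes> v) z" for x z
    by (rule sweedler2_comul[of pointwise_scale]) (intro multilinear)
  then show ?thesis
    unfolding id_comul_def by (subst sweedler2_comul[of pointwise_scale]) (auto intro!: multilinear)
qed

lemma comul_id_in_cube: "comul_id (\<Delta> a) \<in> tensor_cube"
  unfolding comul_id_eq by (intro cosum_in_cube tens3_in_cube)

lemma id_comul_in_cube: "id_comul (\<Delta> a) \<in> tensor_cube"
  unfolding id_comul_eq by (intro cosum_in_cube tens3_in_cube)

lemma comul_id_apply:
  "trilinear_to (*) \<tau> \<Longrightarrow> comul_id (\<Delta> a) \<tau> = cosum (\<lambda>x z. cosum (\<lambda>u v. \<tau> u v z) x) a"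
  unfolding comul_id_eq by (simp add: cosum_apply tens3_def)

lemma id_comul_apply:
  "trilinear_to (*) \<tau> \<Longrightarrow> id_comul (\<Delta> a) \<tau> = cosum (\<lambda>x z. cosum (\<lambda>u v. \<tau> x u v) z) a"
  unfolding id_comul_eq by (simp add: cosum_apply tens3_def)

lemma sweedler3_comul3:
  assumes f: "trilinear_to s f"
  shows "sweedler3 f (\<Delta>\<^sub>3 a) = cosum (\<lambda>x z. cosum (\<lambda>u v. f u v z) x) a"
proof (rule eq_by_functionals[OF trilinear_to_target[OF f]])
  fix \<phi> assume l: "lin s (*) \<phi>"
  have "trilinear_to (*) (\<lambda>x y z. \<phi> (f x y z))"
    by (intro multilinear linear_comp[OF l] trilinear_to_comp[OF f])
  then show "\<phi> (sweedler3 f (\<Delta>\<^sub>3 a)) = \<phi> (cosum (\<lambda>x z. cosum (\<lambda>u v. f u v z) x) a)"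
    unfolding comul3_def
    by (simp add: sweedler3_functional[OF comul_id_in_cube f l] comul_id_apply linear_cosum[OF l])
qed

end

section \<open>Coassociativity and counit laws for nested sums\<close>

context coalgebra
begin

lemma counit_multilinear [multilinear]: "lin r scale g \<Longrightarrow> lin r (*) (\<lambda>x. \<epsilon> (g x))"
  by (rule linear_comp[OF counit_linear])

text \<open>After applying a functional, the two sides are the values of
  \<open>comul_id (\<Delta> a)\<close> and \<open>id_comul (\<Delta> a)\<close> at the same
  trilinear form.\<close>

lemma cosum_coassoc:
  assumes f: "trilinear_to s f"
  shows "cosum (\<lambda>x z. cosum (\<lambda>u v. f u v z) x) a = cosum (\<lambda>x y. cosum (\<lambda>u v. f x u v) y) a"
proof (rule eq_by_functionals[OF trilinear_to_target[OF f]])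
  fix \<phi> assume l: "lin s (*) \<phi>"
  have "trilinear_to (*) (\<lambda>x y z. \<phi> (f x y z))"
    by (intro multilinear linear_comp[OF l] trilinear_to_comp[OF f])
  from comul_id_apply[OF this, of a] id_comul_apply[OF this, of a]
  show "\<phi> (cosum (\<lambda>x z. cosum (\<lambda>u v. f u v z) x) a) = \<phi> (cosum (\<lambda>x y. cosum (\<lambda>u v. f x u v) y) a)"
    by (simp add: linear_cosum[OF l] coassoc)
qed

text \<open>Stated for an arbitrary linear \<open>g\<close> so that a counit can be cancelled inside
  a larger expression.\<close>

lemma cosum_counit_left:
  assumes g: "lin scale s g"
  shows "cosum (\<lambda>x y. s (\<epsilon> x) (g y)) a = g a"
proof -
  have "cosum (\<lambda>x y. \<epsilon> x \<cdot> y) a = a"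
    using counit_left[of a] by (subst (asm) sweedler2_comul[of scale]) (auto intro!: multilinear)
  then have "g a = g (cosum (\<lambda>x y. \<epsilon> x \<cdot> y) a)" by simp
  then show ?thesis by (simp only: linear_cosum[OF g] linear_scale_apply[OF g])
qed

lemma cosum_counit_right:
  assumes g: "lin scale s g"
  shows "cosum (\<lambda>x y. s (\<epsilon> y) (g x)) a = g a"
proof -
  have "cosum (\<lambda>x y. \<epsilon> y \<cdot> x) a = a"
    using counit_right[of a] by (subst (asm) sweedler2_comul[of scale]) (auto intro!: multilinear)
  then have "g a = g (cosum (\<lambda>x y. \<epsilon> y \<cdot> x) a)" by simp
  then show ?thesis by (simp only: linear_cosum[OF g] linear_scale_apply[OF g])
qed

end

section \<open>Products in the tensor square and the tensor cube\<close>

lemma (in fin_dim_algebra) mul_multilinear [multilinear]: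
  "lin r scale g \<Longrightarrow> lin r scale (\<lambda>x. g x \<odot> y)"
  "lin r scale g \<Longrightarrow> lin r scale (\<lambda>x. y \<odot> g x)"
  using bilinear_to_comp[OF mul_bilinear] by blast+

lemma (in fin_dim_algebra) mul3_sum_list:
  "(\<Sum>(x, y, z)\<leftarrow>ps. x \<otimes> y \<otimes> z) \<odot>\<^sub>3 (\<Sum>(x, y, z)\<leftarrow>qs. x \<otimes> y \<otimes> z) =
    (\<Sum>(x, y, z)\<leftarrow>ps. \<Sum>(x', y', z')\<leftarrow>qs. (x \<odot> x') \<otimes> (y \<odot> y') \<otimes> (z \<odot> z'))"
proof -
  have inner: "sweedler3 (\<lambda>x' y' z'. (x \<odot> x') \<otimes> (y \<odot> y') \<otimes> (z \<odot> z')) (\<Sum>(x, y, z)\<leftarrow>qs. x \<otimes> y \<otimes> z) =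
    (\<Sum>(x', y', z')\<leftarrow>qs. (x \<odot> x') \<otimes> (y \<odot> y') \<otimes> (z \<odot> z'))" for x y z
    by (intro sweedler3_tens3_sum[OF vector_space_pointwise] multilinear)
  show ?thesis
    unfolding mul3_def inner
    by (intro sweedler3_tens3_sum[OF vector_space_pointwise] trilinear_toI;
        unfold split_def;
        intro linear_sum_list_fun vector_space_scale vector_space_pointwise multilinear)
qed

text \<open>Product and coproduct are not yet related here, so that these formulas can be used for
  the dual structure while it is being shown to be a weak bialgebra.\<close>

locale algebra_coproduct = fin_dim_algebra scale mul unit + coproduct_space scale comul
  for scale :: "'k::field \<Rightarrow> 'a::ab_group_add \<Rightarrow> 'a" (infixr \<open>\<cdot>\<close> 75)
    and mul :: "'a \<Rightarrow> 'a \<Rightarrow> 'a" (infixl \<open>\<odot>\<close> 70)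
    and unit :: 'a (\<open>\<one>\<close>)
    and comul :: "'a \<Rightarrow> ('k, 'a) tensor2" (\<open>\<Delta>\<close>)
begin

lemma mul2_comul:
  "\<Delta> a \<odot>\<^sub>2 \<Delta> b = cosum (\<lambda>x y. cosum (\<lambda>x' y'. (x \<odot> x') \<otimes> (y \<odot> y')) b) a"
proof -
  have inner: "sweedler2 (\<lambda>x' y'. (x \<odot> x') \<otimes> (y \<odot> y')) (\<Delta> b) =
    cosum (\<lambda>x' y'. (x \<odot> x') \<otimes> (y \<odot> y')) b" for x y
    by (intro sweedler2_comul[of pointwise_scale] multilinear)
  show ?thesis
    unfolding mul2_def inner by (intro sweedler2_comul[of pointwise_scale] multilinear)
qed

lemma mul2_comul_in_square: "\<Delta> a \<odot>\<^sub>2 \<Delta> b \<in> tensor_square"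
  unfolding mul2_comul by (intro cosum_in_square tens2_in_square)

lemma mul2_comul_apply:
  assumes "bilinear_to (*) \<beta>"
  shows "(\<Delta> a \<odot>\<^sub>2 \<Delta> b) \<beta> = cosum (\<lambda>x y. cosum (\<lambda>x' y'. \<beta> (x \<odot> x') (y \<odot> y')) b) a"
  using assms by (simp add: mul2_comul cosum_apply tens2_def)

lemma tensor_unit_right_list:
  "\<Delta> a \<otimes>\<one> = (\<Sum>(x, y, z)\<leftarrow>map (\<lambda>(x, y). (x, y, \<one>)) (coproduct_list a). x \<otimes> y \<otimes> z)"
  unfolding tensor_unit_right_def
  by (subst sweedler2_comul[of pointwise_scale])
    (auto intro!: multilinear simp: cosum_def split_def o_def)

lemma tensor_unit_left_list:
  "\<one>\<otimes> \<Delta> a = (\<Sum>(x, y, z)\<leftarrow>map (\<lambda>(x, y). (\<one>, x, y)) (coproduct_list a). x \<otimes> y \<otimes> z)"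
  unfolding tensor_unit_left_def
  by (subst sweedler2_comul[of pointwise_scale])
    (auto intro!: multilinear simp: cosum_def split_def o_def)

text \<open>The units act trivially on the outer legs, so that only the middle legs are
  multiplied.\<close>

lemma mul3_unit_right_left:
  "(\<Delta> a \<otimes>\<one>) \<odot>\<^sub>3 (\<one>\<otimes> \<Delta> b) = cosum (\<lambda>x y. cosum (\<lambda>u v. x \<otimes> (y \<odot> u) \<otimes> v) b) a"
  unfolding tensor_unit_left_list tensor_unit_right_list mul3_sum_list
  by (simp add: cosum_def split_def o_def unit_left unit_right)

lemma mul3_unit_left_right:
  "(\<one>\<otimes> \<Delta> a) \<odot>\<^sub>3 (\<Delta> b \<otimes>\<one>) = cosum (\<lambda>u v. cosum (\<lambda>x y. x \<otimes> (u \<odot> y) \<otimes> v) b) a"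
  unfolding tensor_unit_left_list tensor_unit_right_list mul3_sum_list
  by (simp add: cosum_def split_def o_def unit_left unit_right)

end

sublocale weak_bialgebra \<subseteq> algebra_coproduct ..

section \<open>Counital maps, and the axioms as nested sums\<close>

context weak_bialgebra
begin

lemma cosum_mul:
  assumes f: "bilinear_to s f"
  shows "cosum f (a \<odot> b) = cosum (\<lambda>x y. cosum (\<lambda>x' y'. f (x \<odot> x') (y \<odot> y')) b) a"
proof (rule eq_by_functionals[OF bilinear_to_target[OF f]])
  fix \<phi> assume l: "lin s (*) \<phi>"
  have "bilinear_to (*) (\<lambda>x y. \<phi> (f x y))"
    by (intro multilinear linear_comp[OF l] bilinear_to_comp[OF f])
  from comul_apply[OF this, of "a \<odot> b"] mul2_comul_apply[OF this, of a b]
  show "\<phi> (cosum f (a \<odot> b)) =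
      \<phi> (cosum (\<lambda>x y. cosum (\<lambda>x' y'. f (x \<odot> x') (y \<odot> y')) b) a)"
    by (simp add: linear_cosum[OF l] comul_mul)
qed

text \<open>The target counital map of weak Hopf algebra theory; \<open>F\<close> is the source
  counital map.\<close>

definition tcounit :: "'a \<Rightarrow> 'a" (\<open>E\<close>)
  where "tcounit a = cosum (\<lambda>x y. \<epsilon> (x \<odot> a) \<cdot> y) \<one>"

definition scounit :: "'a \<Rightarrow> 'a" (\<open>F\<close>)
  where "scounit a = cosum (\<lambda>x y. \<epsilon> (a \<odot> y) \<cdot> x) \<one>"

lemma tcounit_multilinear [multilinear]: "lin scale scale g \<Longrightarrow> lin scale scale (\<lambda>x. E (g x))"
  unfolding tcounit_def by (intro multilinear)

lemma scounit_multilinear [multilinear]: "lin scale scale g \<Longrightarrow> lin scale scale (\<lambda>x. F (g x))"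
  unfolding scounit_def by (intro multilinear)

lemma tcounit_apply:
  assumes "lin scale s g"
  shows "g (E a) = cosum (\<lambda>x y. s (\<epsilon> (x \<odot> a)) (g y)) \<one>"
  by (simp add: tcounit_def linear_cosum[OF assms] linear_scale_apply[OF assms])

lemma scounit_apply:
  assumes "lin scale s g"
  shows "g (F a) = cosum (\<lambda>x y. s (\<epsilon> (a \<odot> y)) (g x)) \<one>"
  by (simp add: scounit_def linear_cosum[OF assms] linear_scale_apply[OF assms])

lemma tcounit_unit: "E \<one> = \<one>"
  unfolding tcounit_def unit_right by (rule cosum_counit_left[OF linear_id])

lemma scounit_unit: "F \<one> = \<one>"
  unfolding scounit_def unit_left by (rule cosum_counit_right[OF linear_id])

lemma pre_antipode_iff:
  "pre_antipode S \<longleftrightarrow> lin scale scale S \<and>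
    (\<forall>a. cosum (\<lambda>x y. x \<odot> S y) a = E a \<and> cosum (\<lambda>x y. S x \<odot> y) a = F a)"
proof -
  have "sweedler2 (\<lambda>x y. x \<odot> S y) (\<Delta> a) = cosum (\<lambda>x y. x \<odot> S y) a"
    "sweedler2 (\<lambda>x y. S x \<odot> y) (\<Delta> a) = cosum (\<lambda>x y. S x \<odot> y) a" if "lin scale scale S" for a
    by (intro sweedler2_comul[of scale] multilinear linear_comp[OF that])+
  moreover have "sweedler2 (\<lambda>x y. \<epsilon> (x \<odot> a) \<cdot> y) (\<Delta> \<one>) = E a"
    "sweedler2 (\<lambda>x y. \<epsilon> (a \<odot> y) \<cdot> x) (\<Delta> \<one>) = F a" for a
    unfolding tcounit_def scounit_def by (intro sweedler2_comul[of scale] multilinear)+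
  ultimately show ?thesis
    unfolding pre_antipode_def by auto
qed

lemma monoidal_iff:
  "monoidal \<longleftrightarrow> (\<forall>a b c.
    \<epsilon> (a \<odot> b \<odot> c) = cosum (\<lambda>x y. \<epsilon> (a \<odot> x) * \<epsilon> (y \<odot> c)) b \<and>
    \<epsilon> (a \<odot> b \<odot> c) = cosum (\<lambda>x y. \<epsilon> (a \<odot> y) * \<epsilon> (x \<odot> c)) b)"
proof -
  have "sweedler2 (\<lambda>x y. \<epsilon> (a \<odot> x) * \<epsilon> (y \<odot> c)) (\<Delta> b) = cosum (\<lambda>x y. \<epsilon> (a \<odot> x) * \<epsilon> (y \<odot> c)) b"
    "sweedler2 (\<lambda>x y. \<epsilon> (a \<odot> y) * \<epsilon> (x \<odot> c)) (\<Delta> b) = cosum (\<lambda>x y. \<epsilon> (a \<odot> y) * \<epsilon> (x \<odot> c)) b"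
    for a b c
    by (intro sweedler2_comul[of "(*)"] multilinear)+
  then show ?thesis unfolding monoidal_def by simp
qed

text \<open>Turns the tensor equations into rewrite rules that merge two copies of
  \<open>\<Delta> \<one>\<close> into one iterated coproduct, or split them again.\<close>

lemma comonoidal_cosum:
  assumes c: comonoidal and f: "trilinear_to s f"
  shows "cosum (\<lambda>x y. cosum (\<lambda>u v. f x (y \<odot> u) v) \<one>) \<one> = cosum (\<lambda>x z. cosum (\<lambda>u v. f u v z) x) \<one>"
    and "cosum (\<lambda>u v. cosum (\<lambda>x y. f x (u \<odot> y) v) \<one>) \<one> = cosum (\<lambda>x z. cosum (\<lambda>u v. f u v z) x) \<one>"
proof -
  note c = c[unfolded comonoidal_def comul3_def mul3_unit_left_right mul3_unit_right_left comul_id_eq]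
  have 1: "\<phi> (cosum (\<lambda>x y. cosum (\<lambda>u v. f x (y \<odot> u) v) \<one>) \<one>) =
      \<phi> (cosum (\<lambda>x z. cosum (\<lambda>u v. f u v z) x) \<one>) \<and>
    \<phi> (cosum (\<lambda>u v. cosum (\<lambda>x y. f x (u \<odot> y) v) \<one>) \<one>) =
      \<phi> (cosum (\<lambda>x z. cosum (\<lambda>u v. f u v z) x) \<one>)" if l: "lin s (*) \<phi>" for \<phi>
  proof -
    let ?\<tau> = "\<lambda>x y z. \<phi> (f x y z)"
    have t: "trilinear_to (*) ?\<tau>"
      by (intro multilinear linear_comp[OF l] trilinear_to_comp[OF f])
    from c[THEN conjunct1, THEN fun_cong, of ?\<tau>] c[THEN conjunct2, THEN fun_cong, of ?\<tau>]
    show ?thesis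
      by (simp add: linear_cosum[OF l] cosum_apply tens3_def t)
  qed
  show "cosum (\<lambda>x y. cosum (\<lambda>u v. f x (y \<odot> u) v) \<one>) \<one> = cosum (\<lambda>x z. cosum (\<lambda>u v. f u v z) x) \<one>"
    "cosum (\<lambda>u v. cosum (\<lambda>x y. f x (u \<odot> y) v) \<one>) \<one> = cosum (\<lambda>x z. cosum (\<lambda>u v. f u v z) x) \<one>"
    using 1 by (auto intro!: eq_by_functionals[OF trilinear_to_target[OF f]])
qed

lemma antipode_iff:
  "antipode S \<longleftrightarrow> pre_antipode S \<and> (\<forall>a. cosum (\<lambda>x y. cosum (\<lambda>u v. S u \<odot> v \<odot> S y) x) a = S a)"
proof -
  have "sweedler3 (\<lambda>x y z. S x \<odot> y \<odot> S z) (\<Delta>\<^sub>3 a) = cosum (\<lambda>x y. cosum (\<lambda>u v. S u \<odot> v \<odot> S y) x) a"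
    if "lin scale scale S" for a
    by (intro sweedler3_comul3[of scale] multilinear linear_comp[OF that])
  then show ?thesis
    unfolding antipode_def pre_antipode_def by metis
qed

lemma cosum_unit_left:
  "bilinear_to s f \<Longrightarrow> cosum (\<lambda>x y. cosum (\<lambda>u v. f (x \<odot> u) (y \<odot> v)) a) \<one> = cosum f a"
  using cosum_mul[of s f \<one> a] by (simp add: unit_left)

lemma cosum_unit_right:
  "bilinear_to s f \<Longrightarrow> cosum (\<lambda>x y. cosum (\<lambda>u v. f (x \<odot> u) (y \<odot> v)) \<one>) a = cosum f a"
  using cosum_mul[of s f a \<one>] by (simp add: unit_right)

text \<open>The counit on the second leg of \<open>\<Delta> \<one>\<close> leaves
  \<open>\<one>\<close> in the first.\<close>

lemma counit_tcounit: "\<epsilon> (E a) = \<epsilon> a"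
proof -
  have "\<epsilon> (E a) = cosum (\<lambda>x y. \<epsilon> (x \<odot> a) * \<epsilon> y) \<one>"
    by (rule tcounit_apply[OF counit_linear])
  also have "\<dots> = cosum (\<lambda>x y. \<epsilon> y * \<epsilon> (x \<odot> a)) \<one>"
    by (simp add: mult.commute)
  also have "\<dots> = \<epsilon> (\<one> \<odot> a)"
    by (rule cosum_counit_right[where s = "(*)"]) (intro multilinear)
  finally show ?thesis by (simp add: unit_left)
qed

text \<open>Both sides expand to the sum of
  \<open>\<epsilon> (a \<odot> y) * \<epsilon> (x \<odot> b)\<close> over
  \<open>\<Delta> \<one>\<close>.\<close>

lemma counit_scounit_mul: "\<epsilon> (F a \<odot> b) = \<epsilon> (a \<odot> E b)"
proof -
  have "\<epsilon> (F a \<odot> b) = cosum (\<lambda>x y. \<epsilon> (a \<odot> y) * \<epsilon> (x \<odot> b)) \<one>"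
    by (rule scounit_apply[where s = "(*)"]) (intro multilinear)
  also have "\<dots> = cosum (\<lambda>x y. \<epsilon> (x \<odot> b) * \<epsilon> (a \<odot> y)) \<one>"
    by (simp add: mult.commute)
  also have "\<dots> = \<epsilon> (a \<odot> E b)"
    by (rule tcounit_apply[where s = "(*)", symmetric]) (intro multilinear)
  finally show ?thesis .
qed

end

section \<open>Comonoidal weak bialgebras\<close>

locale comonoidal_weak_bialgebra = weak_bialgebra +
  assumes comonoidal: comonoidal
begin

text \<open>The coproduct of \<open>E b\<close> is
  \<open>\<epsilon>(1_(1) b) 1_(2) \<otimes> 1_(3)\<close>. Comonoidality splits the iterated
  coproduct into two copies of \<open>\<Delta> \<one>\<close>, one of which sums to
  \<open>E b\<close>.\<close>

lemma cosum_tcounit: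
  assumes f: "bilinear_to s f"
  shows "cosum f (E b) = cosum (\<lambda>x y. f (x \<odot> E b) y) \<one>"
proof -
  note vs = bilinear_to_target[OF f]
  have id: "lin s s (\<lambda>x. x)" using vs by (simp add: Vector_Spaces.linear_iff)
  note ml = multilinear bilinear_to_comp[OF f] linear_scale_const[where t = s]
    linear_scale_vector[OF vs]
  have "cosum f (E b) = cosum (\<lambda>x y. s (\<epsilon> (x \<odot> b)) (cosum f y)) \<one>"
    by (rule tcounit_apply[OF linear_cosum_arg[OF f]])
  also have "\<dots> = cosum (\<lambda>x y. cosum (\<lambda>u v. s (\<epsilon> (x \<odot> b)) (f u v)) y) \<one>"
    by (simp only: linear_cosum[OF linear_scale_const[OF id]])
  also have "\<dots> = cosum (\<lambda>x z. cosum (\<lambda>u v. s (\<epsilon> (u \<odot> b)) (f v z)) x) \<one>"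
    by (rule cosum_coassoc[where s = s, symmetric]) (intro ml)
  also have "\<dots> = cosum (\<lambda>u v. cosum (\<lambda>x y. s (\<epsilon> (x \<odot> b)) (f (u \<odot> y) v)) \<one>) \<one>"
    by (rule comonoidal_cosum(2)[OF comonoidal, where s = s, symmetric]) (intro ml)
  also have "\<dots> = cosum (\<lambda>u v. f (u \<odot> E b) v) \<one>"
    by (subst tcounit_apply[where s = s]) (auto intro!: ml)
  finally show ?thesis .
qed

text \<open>The two orders of multiplication in the comonoidality axiom give the two claims:
  \<open>F b\<close> may stand on either side of the second leg.\<close>

lemma cosum_scounit:
  assumes f: "bilinear_to s f"
  shows "cosum f (F b) = cosum (\<lambda>x y. f x (F b \<odot> y)) \<one>"
    and "cosum f (F b) = cosum (\<lambda>x y. f x (y \<odot> F b)) \<one>"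
proof -
  note vs = bilinear_to_target[OF f]
  have id: "lin s s (\<lambda>x. x)" using vs by (simp add: Vector_Spaces.linear_iff)
  note ml = multilinear bilinear_to_comp[OF f] linear_scale_const[where t = s]
    linear_scale_vector[OF vs]
  have "cosum f (F b) = cosum (\<lambda>x y. s (\<epsilon> (b \<odot> y)) (cosum f x)) \<one>"
    by (rule scounit_apply[OF linear_cosum_arg[OF f]])
  also have "\<dots> = cosum (\<lambda>x z. cosum (\<lambda>u v. s (\<epsilon> (b \<odot> z)) (f u v)) x) \<one>"
    by (simp only: linear_cosum[OF linear_scale_const[OF id]])
  finally have *: "cosum f (F b) = \<dots>" .
  have "\<dots> = cosum (\<lambda>x y. cosum (\<lambda>u v. s (\<epsilon> (b \<odot> v)) (f x (y \<odot> u))) \<one>) \<one>"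
    by (rule comonoidal_cosum(1)[OF comonoidal, where s = s, symmetric]) (intro ml)
  also have "\<dots> = cosum (\<lambda>x y. f x (y \<odot> F b)) \<one>"
    by (subst scounit_apply[where s = s]) (auto intro!: ml)
  finally show "cosum f (F b) = cosum (\<lambda>x y. f x (y \<odot> F b)) \<one>"
    using * by simp
  have "cosum (\<lambda>x z. cosum (\<lambda>u v. s (\<epsilon> (b \<odot> z)) (f u v)) x) \<one>
      = cosum (\<lambda>u v. cosum (\<lambda>x y. s (\<epsilon> (b \<odot> v)) (f x (u \<odot> y))) \<one>) \<one>"
    by (rule comonoidal_cosum(2)[OF comonoidal, where s = s, symmetric]) (intro ml)
  also have "\<dots> = cosum (\<lambda>x y. cosum (\<lambda>u v. s (\<epsilon> (b \<odot> v)) (f x (u \<odot> y))) \<one>) \<one>"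
    by (rule cosum_swap)
  also have "\<dots> = cosum (\<lambda>x y. f x (F b \<odot> y)) \<one>"
    by (subst scounit_apply[where s = s]) (auto intro!: ml)
  finally show "cosum f (F b) = cosum (\<lambda>x y. f x (F b \<odot> y)) \<one>"
    using * by simp
qed

text \<open>Multiplicativity reduces this to the coproduct of \<open>E b\<close>, and the remaining
  copy of \<open>\<Delta> \<one>\<close> is absorbed by that of \<open>c\<close>. The next two
  lemmas follow the same pattern.\<close>

lemma cosum_mul_tcounit:
  assumes f: "bilinear_to s f"
  shows "cosum f (c \<odot> E b) = cosum (\<lambda>x y. f (x \<odot> E b) y) c"
proof -
  note ml = multilinear bilinear_to_comp[OF f]
  have "cosum f (c \<odot> E b) = cosum (\<lambda>x y. cosum (\<lambda>u v. f (x \<odot> u) (y \<odot> v)) (E b)) c"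
    by (rule cosum_mul[OF f])
  also have "\<dots> = cosum (\<lambda>x y. cosum (\<lambda>u v. f (x \<odot> (u \<odot> E b)) (y \<odot> v)) \<one>) c"
    by (subst cosum_tcounit[where s = s]) (auto intro!: ml)
  also have "\<dots> = cosum (\<lambda>x y. cosum (\<lambda>u v. f ((x \<odot> u) \<odot> E b) (y \<odot> v)) \<one>) c"
    by (simp add: mul_assoc)
  also have "\<dots> = cosum (\<lambda>x y. f (x \<odot> E b) y) c"
    by (rule cosum_unit_right[where s = s]) (intro ml)
  finally show ?thesis .
qed

lemma cosum_mul_scounit:
  assumes f: "bilinear_to s f"
  shows "cosum f (c \<odot> F b) = cosum (\<lambda>x y. f x (y \<odot> F b)) c"
proof -
  note ml = multilinear bilinear_to_comp[OF f]
  have "cosum f (c \<odot> F b) = cosum (\<lambda>x y. cosum (\<lambda>u v. f (x \<odot> u) (y \<odot> v)) (F b)) c"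
    by (rule cosum_mul[OF f])
  also have "\<dots> = cosum (\<lambda>x y. cosum (\<lambda>u v. f (x \<odot> u) (y \<odot> (v \<odot> F b))) \<one>) c"
    by (subst cosum_scounit(2)[where s = s]) (auto intro!: ml)
  also have "\<dots> = cosum (\<lambda>x y. cosum (\<lambda>u v. f (x \<odot> u) ((y \<odot> v) \<odot> F b)) \<one>) c"
    by (simp add: mul_assoc)
  also have "\<dots> = cosum (\<lambda>x y. f x (y \<odot> F b)) c"
    by (rule cosum_unit_right[where s = s]) (intro ml)
  finally show ?thesis .
qed

lemma cosum_scounit_mul:
  assumes f: "bilinear_to s f"
  shows "cosum f (F b \<odot> c) = cosum (\<lambda>x y. f x (F b \<odot> y)) c"
proof -
  note ml = multilinear bilinear_to_comp[OF f]
  have "cosum f (F b \<odot> c) = cosum (\<lambda>u v. cosum (\<lambda>x y. f (u \<odot> x) (v \<odot> y)) c) (F b)"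
    by (rule cosum_mul[OF f])
  also have "\<dots> = cosum (\<lambda>u v. cosum (\<lambda>x y. f (u \<odot> x) ((F b \<odot> v) \<odot> y)) c) \<one>"
    by (rule cosum_scounit(1)[where s = s]) (intro ml)
  also have "\<dots> = cosum (\<lambda>u v. cosum (\<lambda>x y. f (u \<odot> x) (F b \<odot> (v \<odot> y))) c) \<one>"
    by (simp add: mul_assoc)
  also have "\<dots> = cosum (\<lambda>x y. f x (F b \<odot> y)) c"
    by (rule cosum_unit_left[where s = s]) (intro ml)
  finally show ?thesis .
qed

text \<open>Both products equal the sum of \<open>\<epsilon> (x \<odot> a) \<cdot> \<epsilon> (b
  \<odot> z) \<cdot> y\<close> over the iterated coproduct of \<open>\<one>\<close>, because
  comonoidality allows either order in the middle leg.\<close>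

lemma tcounit_scounit_commute: "E a \<odot> F b = F b \<odot> E a"
proof -
  have t: "trilinear_to scale (\<lambda>x y z. \<epsilon> (x \<odot> a) \<cdot> \<epsilon> (b \<odot> z) \<cdot> y)"
    by (intro multilinear)
  have "E a \<odot> F b = cosum (\<lambda>x y. \<epsilon> (x \<odot> a) \<cdot> (y \<odot> F b)) \<one>"
    by (rule tcounit_apply[where s = scale]) (intro multilinear)
  also have "\<dots> = cosum (\<lambda>x y. cosum (\<lambda>u v. \<epsilon> (x \<odot> a) \<cdot> \<epsilon> (b \<odot> v) \<cdot> (y \<odot> u)) \<one>) \<one>"
    by (subst scounit_apply[where s = scale and a = b]) (auto intro!: multilinear simp: linear_cosum[OF linear_scale_const_scale[OF linear_id]])
  also have "\<dots> = cosum (\<lambda>u v. cosum (\<lambda>x y. \<epsilon> (x \<odot> a) \<cdot> \<epsilon> (b \<odot> v) \<cdot> (u \<odot> y)) \<one>) \<one>"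
    using comonoidal_cosum[OF comonoidal t] by simp
  also have "\<dots> = cosum (\<lambda>u v. \<epsilon> (b \<odot> v) \<cdot> (u \<odot> E a)) \<one>"
    by (subst tcounit_apply[where s = scale]) (auto intro!: multilinear)
  also have "\<dots> = F b \<odot> E a"
    by (rule scounit_apply[where s = scale, symmetric]) (intro multilinear)
  finally show ?thesis .
qed

text \<open>A copy of \<open>\<Delta> \<one>\<close> is split off from \<open>\<Delta> a\<close> and
  merged with the one inside \<open>E\<close>. The counit then removes the second leg of
  \<open>\<Delta> (r \<odot> a)\<close>, where \<open>r\<close> is the first leg of the remaining
  \<open>\<Delta> \<one>\<close>.\<close>

lemma cosum_tcounit_second:
  assumes f: "bilinear_to s f"
  shows "cosum (\<lambda>x y. f x (E y)) a = cosum (\<lambda>x y. f (x \<odot> a) y) \<one>"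
proof -
  note vs = bilinear_to_target[OF f]
  have id: "lin s s (\<lambda>x. x)" using vs by (simp add: Vector_Spaces.linear_iff)
  note ml = multilinear bilinear_to_comp[OF f] linear_scale_const[where t = s]
    linear_scale_vector[OF vs]
  have "cosum (\<lambda>x y. f x (E y)) a =
      cosum (\<lambda>p q. cosum (\<lambda>x y. f (p \<odot> x) (E (q \<odot> y))) a) \<one>"
    by (rule cosum_unit_left[where s = s, symmetric]) (intro ml)
  also have "\<dots> = cosum (\<lambda>x y. cosum (\<lambda>p q. f (p \<odot> x) (E (q \<odot> y))) \<one>) a"
    by (rule cosum_swap)
  also have "\<dots> = cosum (\<lambda>x y. cosum (\<lambda>p q. cosum (\<lambda>u v. s (\<epsilon> (u \<odot> (q \<odot> y))) (f (p \<odot> x) v)) \<one>) \<one>) a"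
    by (subst tcounit_apply[where s = s]) (auto intro!: ml)
  also have "\<dots> = cosum (\<lambda>x y. cosum (\<lambda>u v. cosum (\<lambda>p q. s (\<epsilon> ((u \<odot> q) \<odot> y)) (f (p \<odot> x) v)) \<one>) \<one>) a"
    by (subst cosum_swap[of _ \<one> \<one>]) (simp only: mul_assoc)
  also have "\<dots> = cosum (\<lambda>x y. cosum (\<lambda>r v. cosum (\<lambda>p q. s (\<epsilon> (q \<odot> y)) (f (p \<odot> x) v)) r) \<one>) a"
    by (subst comonoidal_cosum(2)[OF comonoidal, where s = s]) (auto intro!: ml)
  also have "\<dots> = cosum (\<lambda>r v. cosum (\<lambda>x y. cosum (\<lambda>p q. s (\<epsilon> (q \<odot> y)) (f (p \<odot> x) v)) r) a) \<one>"
    by (rule cosum_swap)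
  also have "\<dots> = cosum (\<lambda>r v. cosum (\<lambda>p q. cosum (\<lambda>x y. s (\<epsilon> (q \<odot> y)) (f (p \<odot> x) v)) a) r) \<one>"
    by (subst cosum_swap[of _ a]) simp
  also have "\<dots> = cosum (\<lambda>r v. cosum (\<lambda>x y. s (\<epsilon> y) (f x v)) (r \<odot> a)) \<one>"
    by (subst cosum_mul[where s = s]) (auto intro!: ml)
  also have "\<dots> = cosum (\<lambda>r v. f (r \<odot> a) v) \<one>"
    by (subst cosum_counit_right[where s = s]) (auto intro!: ml)
  finally show ?thesis .
qed

text \<open>Comonoidality merges the copy of \<open>\<Delta> \<one>\<close> inside \<open>F\<close>
  with the given one, and the counit cancels the middle leg.\<close>

lemma cosum_scounit_first:
  assumes f: "bilinear_to s f"
  shows "cosum (\<lambda>x y. f (F x) y) \<one> = cosum f \<one>"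
proof -
  note vs = bilinear_to_target[OF f]
  note ml = multilinear bilinear_to_comp[OF f] linear_scale_const[where t = s]
    linear_scale_vector[OF vs]
  have "cosum (\<lambda>x y. f (F x) y) \<one> =
      cosum (\<lambda>u v. cosum (\<lambda>x y. s (\<epsilon> (u \<odot> y)) (f x v)) \<one>) \<one>"
    by (subst scounit_apply[where s = s]) (auto intro!: ml)
  also have "\<dots> = cosum (\<lambda>r v. cosum (\<lambda>x y. s (\<epsilon> y) (f x v)) r) \<one>"
    by (rule comonoidal_cosum(2)[OF comonoidal, where s = s]) (intro ml)
  also have "\<dots> = cosum f \<one>"
    by (subst cosum_counit_right[where s = s]) (auto intro!: ml)
  finally show ?thesis .
qed

lemma scounit_idem: "F (F a) = F a"
proof -
  have "F (F a) = cosum (\<lambda>x y. \<epsilon> (a \<odot> y) \<cdot> F x) \<one>"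
    by (rule scounit_apply[where s = scale]) (intro multilinear)
  also have "\<dots> = F a"
    unfolding scounit_def[of a] by (rule cosum_scounit_first[where s = scale]) (intro multilinear)
  finally show ?thesis .
qed

lemma tcounit_idem: "E (E a) = E a"
proof -
  have "E (E a) = cosum (\<lambda>x y. \<epsilon> (x \<odot> a) \<cdot> E y) \<one>"
    by (rule tcounit_apply[where s = scale]) (intro multilinear)
  also have "\<dots> = cosum (\<lambda>x y. \<epsilon> ((x \<odot> \<one>) \<odot> a) \<cdot> y) \<one>"
    by (rule cosum_tcounit_second[where s = scale]) (intro multilinear)
  finally show ?thesis by (simp add: unit_right tcounit_def)
qed

end

section \<open>Finite dimension: injective endomorphisms of a subspace are onto\<close>

locale fin_dim_space = tensor_space scale
  for scale :: "'k::field \<Rightarrow> 'a::ab_group_add \<Rightarrow> 'a" (infixr \<open>\<cdot>\<close> 75) +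
  assumes finite_spanning: "\<exists>B. finite B \<and> span B = UNIV"

sublocale fin_dim_algebra \<subseteq> fin_dim_space
  by unfold_locales (rule finite_dim)

lemma (in fin_dim_space) finite_dimensional:
  obtains B where "finite_dimensional_vector_space scale B"
proof -
  obtain C where C: "finite C" "span C = UNIV" using finite_spanning by blast
  obtain B where B: "B \<subseteq> C" "independent B" "C \<subseteq> span B"
    using maximal_independent_subset[of C] by blast
  have "span B = UNIV" using C B(3) by (metis span_mono span_span top.extremum_unique)
  with B C have "finite_dimensional_vector_space scale B"
    by unfold_locales (auto intro: finite_subset)
  then show thesis by (rule that)
qed

text \<open>The image is a subspace of \<open>R\<close> of the same dimension.\<close>

lemma (in fin_dim_space) linear_inj_on_subspace_surj:
  assumes T: "lin scale scale T" and R: "subspace R" "T ` R \<subseteq> R" and inj: "inj_on T R"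
  shows "T ` R = R"
proof -
  obtain B where "finite_dimensional_vector_space scale B" by (rule finite_dimensional)
  then interpret V: finite_dimensional_vector_space scale B .
  interpret P: finite_dimensional_vector_space_pair_1 scale B scale ..
  interpret T: Vector_Spaces.linear scale scale T by fact
  have "dim (T ` R) = dim R"
    using R(1) inj by (intro P.dim_image_eq[OF T] inj_on_subset[OF inj] span_minimal order_refl)
  then show ?thesis
    using R by (intro V.subspace_dim_equal T.subspace_image) auto
qed

section \<open>A pre-antipode on a comonoidal weak bialgebra\<close>

locale comonoidal_pre_antipode = comonoidal_weak_bialgebra +
  fixes S
  assumes pre_antipode: "pre_antipode S"
begin

lemma S_linear: "lin scale scale S"
  using pre_antipode by (simp add: pre_antipode_iff)

lemma S_multilinear [multilinear]: "lin r scale g \<Longrightarrow> lin r scale (\<lambda>x. S (g x))"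
  by (rule linear_comp[OF S_linear])

lemma cosum_id_S: "cosum (\<lambda>x y. x \<odot> S y) a = E a"
  using pre_antipode by (simp add: pre_antipode_iff)

lemma cosum_S_id: "cosum (\<lambda>x y. S x \<odot> y) a = F a"
  using pre_antipode by (simp add: pre_antipode_iff)

lemma linear_mul_left: "lin scale scale (\<lambda>x. a \<odot> x)"
  by (intro multilinear)

lemma linear_mul_right: "lin scale scale (\<lambda>x. x \<odot> a)"
  by (intro multilinear)

text \<open>The coproduct of \<open>a \<odot> E b\<close> carries \<open>E b\<close> in its first
  leg only, which puts it between \<open>x\<close> and \<open>S y\<close>.\<close>

lemma tcounit_mul_tcounit: "E (a \<odot> E b) = cosum (\<lambda>x y. x \<odot> E b \<odot> S y) a"
  unfolding cosum_id_S[symmetric, of "a \<odot> E b"]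
  by (rule cosum_mul_tcounit[where s = scale]) (intro multilinear)

lemma scounit_scounit_mul: "F (F a \<odot> b) = cosum (\<lambda>x y. S x \<odot> F a \<odot> y) b"
  unfolding cosum_S_id[symmetric, of "F a \<odot> b"] mul_assoc
  by (rule cosum_scounit_mul[where s = scale]) (intro multilinear)

text \<open>Expanding \<open>E y\<close> by the pre-antipode law and reassociating gives the
  threefold sum, so the antipode law can be checked on a single coproduct.\<close>

lemma cosum_S_tcounit_unfold:
  "cosum (\<lambda>x y. S x \<odot> E y) a = cosum (\<lambda>x y. cosum (\<lambda>u v. S u \<odot> v \<odot> S y) x) a"
proof -
  have "cosum (\<lambda>x y. S x \<odot> E y) a = cosum (\<lambda>x y. cosum (\<lambda>u v. S x \<odot> u \<odot> S v) y) a"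
    by (simp add: cosum_id_S[symmetric] linear_cosum[OF linear_mul_left] mul_assoc)
  also have "\<dots> = cosum (\<lambda>x y. cosum (\<lambda>u v. S u \<odot> v \<odot> S y) x) a"
    by (rule cosum_coassoc[where s = scale, symmetric]) (intro multilinear)
  finally show ?thesis .
qed

lemma antipode_iff_cosum: "antipode S \<longleftrightarrow> (\<forall>a. cosum (\<lambda>x y. S x \<odot> E y) a = S a)"
  by (simp add: antipode_iff pre_antipode cosum_S_tcounit_unfold)

lemma counit_zero: "\<epsilon> 0 = 0"
proof -
  interpret Vector_Spaces.linear scale "(*)" \<epsilon> by (rule counit_linear)
  show ?thesis by simp
qed

lemma mul_zero: "a \<odot> 0 = 0" "0 \<odot> a = 0"
proof -
  interpret l: Vector_Spaces.linear scale scale "\<lambda>x. a \<odot> x" by (rule linear_mul_left)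
  interpret r: Vector_Spaces.linear scale scale "\<lambda>x. x \<odot> a" by (rule linear_mul_right)
  show "a \<odot> 0 = 0" "0 \<odot> a = 0" by simp_all
qed

section \<open>Consequences of anti-multiplicativity\<close>

context
  assumes anti: "anti_multiplicative S"
begin

lemma S_mul: "S (a \<odot> b) = S b \<odot> S a"
  using anti by (simp add: anti_multiplicative_def)

text \<open>Anti-multiplicativity nests the legs of \<open>b\<close> between those of
  \<open>a\<close>, where they contract to \<open>E b\<close>. By \<open>tcounit_mul_tcounit\<close>
  the element \<open>a \<odot> E b\<close> leads to the same sum.\<close>

lemma tcounit_mul: "E (a \<odot> b) = E (a \<odot> E b)"
proof -
  have "E (a \<odot> b) = cosum (\<lambda>x y. cosum (\<lambda>u v. (x \<odot> u) \<odot> S (y \<odot> v)) b) a"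
    unfolding cosum_id_S[symmetric, of "a \<odot> b"]
    by (rule cosum_mul[where s = scale]) (intro multilinear)
  also have "\<dots> = cosum (\<lambda>x y. cosum (\<lambda>u v. x \<odot> (u \<odot> S v) \<odot> S y) b) a"
    by (simp add: S_mul mul_assoc)
  also have "\<dots> = cosum (\<lambda>x y. x \<odot> E b \<odot> S y) a"
    by (simp only: linear_cosum[OF linear_mul_left, symmetric]
        linear_cosum[OF linear_mul_right, symmetric] cosum_id_S)
  finally show ?thesis by (simp add: tcounit_mul_tcounit)
qed

lemma counit_mul_tcounit: "\<epsilon> (a \<odot> E b) = \<epsilon> (a \<odot> b)"
  by (metis counit_tcounit tcounit_mul)

lemma counit_scounit_mul': "\<epsilon> (F a \<odot> b) = \<epsilon> (a \<odot> b)"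
  by (simp add: counit_scounit_mul counit_mul_tcounit)

text \<open>As \<open>E a\<close> occurs in only one leg of its coproduct, \<open>S (E a)\<close>
  can be pulled out of the pre-antipode sum, which leaves \<open>F \<one> = \<one>\<close>.\<close>

lemma scounit_tcounit: "F (E a) = S (E a)"
proof -
  \<comment> \<open>The factor \<open>\<one>\<close> is inserted to match
    \<open>cosum_mul_tcounit\<close>.\<close>
  have "F (\<one> \<odot> E a) = cosum (\<lambda>x y. S (x \<odot> E a) \<odot> y) \<one>"
    unfolding cosum_S_id[symmetric, of "\<one> \<odot> E a"]
    by (rule cosum_mul_tcounit[where s = scale]) (intro multilinear)
  also have "\<dots> = S (E a) \<odot> cosum (\<lambda>x y. S x \<odot> y) \<one>"
    by (simp only: S_mul mul_assoc linear_cosum[OF linear_mul_left])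
  finally show ?thesis by (simp add: cosum_S_id scounit_unit unit_right unit_left)
qed

lemma tcounit_scounit: "E (F a) = S (F a)"
proof -
  have "E (F a \<odot> \<one>) = cosum (\<lambda>x y. x \<odot> S (F a \<odot> y)) \<one>"
    unfolding cosum_id_S[symmetric, of "F a \<odot> \<one>"]
    by (rule cosum_scounit_mul[where s = scale]) (intro multilinear)
  also have "\<dots> = cosum (\<lambda>x y. x \<odot> S y) \<one> \<odot> S (F a)"
    by (simp only: S_mul mul_assoc[symmetric] linear_cosum[OF linear_mul_right])
  finally show ?thesis by (simp add: cosum_id_S tcounit_unit unit_right unit_left)
qed

text \<open>By \<open>cosum_tcounit_second\<close> the element \<open>a\<close> moves into the first
  leg of \<open>\<Delta> \<one>\<close>, from where \<open>S a\<close> factors out to the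
  left.\<close>

lemma antipode_if_anti_multiplicative: "antipode S"
  unfolding antipode_iff_cosum
proof
  fix a
  have "cosum (\<lambda>x y. S x \<odot> E y) a = cosum (\<lambda>x y. S (x \<odot> a) \<odot> y) \<one>"
    by (rule cosum_tcounit_second[where s = scale]) (intro multilinear)
  also have "\<dots> = S a \<odot> cosum (\<lambda>x y. S x \<odot> y) \<one>"
    by (simp only: S_mul mul_assoc linear_cosum[OF linear_mul_left])
  finally show "cosum (\<lambda>x y. S x \<odot> E y) a = S a"
    by (simp add: cosum_S_id scounit_unit unit_right)
qed

text \<open>Since \<open>S (F a) = E (F a)\<close> and \<open>\<epsilon>\<close> does not
  distinguish \<open>F a\<close> from \<open>E (F a)\<close> on the right of a product, the
  hypothesis makes \<open>\<epsilon> (b \<odot> F a)\<close> vanish for all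
  \<open>b\<close>.\<close>

lemma S_scounit_eq_0:
  assumes "S (F a) = 0"
  shows "F a = 0"
proof -
  have *: "\<epsilon> (b \<odot> F a) = 0" for b
    using counit_mul_tcounit[of b "F a"] assms
    by (simp add: tcounit_scounit mul_zero counit_zero)
  have "F a = cosum (\<lambda>x y. \<epsilon> (F a \<odot> y) \<cdot> x) \<one>"
    by (simp add: scounit_def[symmetric] scounit_idem)
  \<comment> \<open>With \<open>E y\<close> in place of \<open>y\<close> the two factors commute,
    and the coefficient becomes one of those known to vanish.\<close>
  also have "\<dots> = cosum (\<lambda>x y. \<epsilon> (F a \<odot> E y) \<cdot> x) \<one>"
    using cosum_tcounit_second[of scale "\<lambda>x y. \<epsilon> (F a \<odot> y) \<cdot> x" \<one>]
    by (simp add: multilinear unit_right)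
  also have "\<dots> = cosum (\<lambda>x y. 0 \<cdot> x) \<one>"
    by (simp only: tcounit_scounit_commute[symmetric] *)
  finally show ?thesis by (simp add: cosum_def split_def)
qed

text \<open>The mirror argument: \<open>\<epsilon> (E a \<odot> b)\<close> vanishes for all
  \<open>b\<close>, and the first leg of \<open>\<Delta> \<one>\<close> may be replaced by its image
  under \<open>F\<close>, which commutes with \<open>E a\<close>.\<close>

lemma S_tcounit_eq_0:
  assumes "S (E a) = 0"
  shows "E a = 0"
proof -
  have *: "\<epsilon> (E a \<odot> b) = 0" for b
    using counit_scounit_mul'[of "E a" b] assms
    by (simp add: scounit_tcounit mul_zero counit_zero)
  have "E a = cosum (\<lambda>x y. \<epsilon> (x \<odot> E a) \<cdot> y) \<one>"
    by (simp add: tcounit_def[symmetric] tcounit_idem)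
  also have "\<dots> = cosum (\<lambda>x y. \<epsilon> (F x \<odot> E a) \<cdot> y) \<one>"
    by (rule cosum_scounit_first[where s = scale, symmetric]) (intro multilinear)
  also have "\<dots> = cosum (\<lambda>x y. 0 \<cdot> y) \<one>"
    by (simp only: tcounit_scounit_commute[symmetric] *)
  finally show ?thesis by (simp add: cosum_def split_def)
qed

text \<open>
  By finite dimension the injective map \<open>S\<^sup>2\<close> is onto the range of \<open>E\<close>, so \<open>S\<close> maps the
  range of \<open>F\<close> onto that of \<open>E\<close>.
\<close>

lemma tcounit_eq_S_scounit: "\<exists>b. E a = S (F b)"
proof -
  interpret S: Vector_Spaces.linear scale scale S by (rule S_linear)
  interpret E: Vector_Spaces.linear scale scale E by (intro multilinear)
  let ?T = "\<lambda>x. S (S x)"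
  have T: "lin scale scale ?T" by (intro multilinear)
  interpret T: Vector_Spaces.linear scale scale ?T by (rule T)
  have R: "subspace (range E)" by (rule E.subspace_image) simp
  have ST: "?T (E b) = S (F (E b))" for b
    by (simp add: scounit_tcounit)
  \<comment> \<open>If \<open>S (F (E b)) = 0\<close>, then \<open>F (E b) = S (E b)\<close>
    vanishes, and hence so does \<open>E b\<close>.\<close>
  have "inj_on ?T (range E)"
    unfolding T.inj_on_iff_eq_0[OF R]
    by (metis ST S_scounit_eq_0 S_tcounit_eq_0 scounit_tcounit imageE)
  \<comment> \<open>Since \<open>S (F (E b)) = E (F (E b))\<close>, the range of \<open>E\<close> is
    preserved.\<close>
  then have "?T ` range E = range E"
    using T R by (intro linear_inj_on_subspace_surj) (auto simp: ST tcounit_scounit[symmetric])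
  then have "E a \<in> ?T ` range E" by blast
  then show ?thesis using ST by auto
qed

text \<open>The value \<open>\<epsilon> (b \<odot> a)\<close> depends on \<open>a\<close> only
  through \<open>E a\<close>, and \<open>E a = S (F c) = E (F c)\<close> for a suitable
  \<open>c\<close>.\<close>

lemma counit_eq_counit_scounit: "\<exists>c. \<forall>b. \<epsilon> (b \<odot> a) = \<epsilon> (b \<odot> F c)"
proof -
  obtain c where "E a = S (F c)" using tcounit_eq_S_scounit by blast
  then show ?thesis
    by (metis counit_mul_tcounit tcounit_scounit)
qed

text \<open>The two identities replace \<open>c\<close> differently: an element of the range of
  \<open>F\<close> slides into the second leg of \<open>\<Delta> b\<close>, one of the range of
  \<open>E\<close> into the first. The counit law for the resulting product then applies.\<close>

lemma monoidal_if_anti_multiplicative: monoidal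
  unfolding monoidal_iff
proof (intro allI conjI)
  fix a b c
  have l: "lin scale (*) (\<lambda>x. \<epsilon> (a \<odot> x))" by (intro multilinear)
  obtain d where d: "\<epsilon> (b \<odot> c) = \<epsilon> (b \<odot> F d)" for b
    using counit_eq_counit_scounit by blast
  have "cosum (\<lambda>x y. \<epsilon> (a \<odot> x) * \<epsilon> (y \<odot> c)) b = cosum (\<lambda>x y. \<epsilon> (a \<odot> x) * \<epsilon> (y \<odot> F d)) b"
    by (simp only: d)
  also have "\<dots> = cosum (\<lambda>x y. \<epsilon> (a \<odot> x) * \<epsilon> y) (b \<odot> F d)"
    by (rule cosum_mul_scounit[where s = "(*)", symmetric]) (intro multilinear)
  also have "\<dots> = \<epsilon> (a \<odot> (b \<odot> F d))"
    using cosum_counit_right[OF l] by (simp add: mult.commute)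
  also have "\<dots> = \<epsilon> (a \<odot> b \<odot> c)"
    by (simp add: d flip: mul_assoc)
  finally show "\<epsilon> (a \<odot> b \<odot> c) = cosum (\<lambda>x y. \<epsilon> (a \<odot> x) * \<epsilon> (y \<odot> c)) b" ..
  have "cosum (\<lambda>x y. \<epsilon> (a \<odot> y) * \<epsilon> (x \<odot> c)) b = cosum (\<lambda>x y. \<epsilon> (a \<odot> y) * \<epsilon> (x \<odot> E c)) b"
    by (simp only: counit_mul_tcounit)
  also have "\<dots> = cosum (\<lambda>x y. \<epsilon> (a \<odot> y) * \<epsilon> x) (b \<odot> E c)"
    by (rule cosum_mul_tcounit[where s = "(*)", symmetric]) (intro multilinear)
  also have "\<dots> = \<epsilon> (a \<odot> (b \<odot> E c))"
    using cosum_counit_left[OF l] by (simp add: mult.commute)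
  also have "\<dots> = \<epsilon> (a \<odot> b \<odot> c)"
    by (simp add: counit_mul_tcounit flip: mul_assoc)
  finally show "\<epsilon> (a \<odot> b \<odot> c) = cosum (\<lambda>x y. \<epsilon> (a \<odot> y) * \<epsilon> (x \<odot> c)) b" ..
qed

end

section \<open>From monoidality and the antipode law back to anti-multiplicativity\<close>

lemma anti_multiplicative_if_antipode:
  assumes monoidal "antipode S"
  shows "anti_multiplicative S"
  unfolding anti_multiplicative_def
proof (intro allI)
  fix a b
  \<comment> \<open>The second monoidality identity with middle factor
    \<open>\<one>\<close>.\<close>
  have counit_mul_tcounit: "\<epsilon> (c \<odot> E d) = \<epsilon> (c \<odot> d)" for c d
  proof -
    have "\<epsilon> (c \<odot> E d) = cosum (\<lambda>x y. \<epsilon> (x \<odot> d) * \<epsilon> (c \<odot> y)) \<one>"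
      by (rule tcounit_apply) (intro multilinear)
    also have "\<dots> = \<epsilon> (c \<odot> d)"
      using assms(1)[unfolded monoidal_iff, rule_format, of c \<one> d, THEN conjunct2]
      by (simp add: unit_right mult.commute)
    finally show ?thesis .
  qed
  have tcounit_mul: "E (c \<odot> d) = E (c \<odot> E d)" for c d
    unfolding tcounit_def[of "c \<odot> d"] tcounit_def[of "c \<odot> E d"]
    by (simp add: counit_mul_tcounit flip: mul_assoc)
  have scounit_mul: "F (c \<odot> d) = F (F c \<odot> d)" for c d
    unfolding scounit_def[of "c \<odot> d"] scounit_def[of "F c \<odot> d"]
    by (simp add: counit_scounit_mul counit_mul_tcounit mul_assoc)
  \<comment> \<open>The antipode law can be contracted on either side: its last two factors give
    \<open>E\<close>, its first two give \<open>F\<close>.\<close>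
  have S_eq: "cosum (\<lambda>x y. S x \<odot> E y) c = S c" for c
    using assms(2) by (simp add: antipode_iff_cosum)
  have S_eq': "cosum (\<lambda>x y. F x \<odot> S y) c = S c" for c
    using assms(2)
    by (simp add: antipode_iff cosum_S_id[symmetric] linear_cosum[OF linear_mul_right])
  have "S (a \<odot> b) = cosum (\<lambda>x y. cosum (\<lambda>u v. S (x \<odot> u) \<odot> E (y \<odot> v)) b) a"
    unfolding S_eq[symmetric, of "a \<odot> b"]
    by (rule cosum_mul[where s = scale]) (intro multilinear)
  \<comment> \<open>Monoidality replaces \<open>E (y \<odot> v)\<close> by
    \<open>E (y \<odot> E v)\<close>, which is a sum over \<open>\<Delta> y\<close>.\<close>
  also have "\<dots> = cosum (\<lambda>x y. cosum (\<lambda>u v. S (x \<odot> u) \<odot> cosum (\<lambda>p q. p \<odot> E v \<odot> S q) y) b) a"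
    by (simp only: tcounit_mul_tcounit[symmetric] tcounit_mul[symmetric])
  also have "\<dots> = cosum (\<lambda>x y. cosum (\<lambda>p q. cosum (\<lambda>u v. S (x \<odot> u) \<odot> (p \<odot> E v \<odot> S q)) b) y) a"
    by (simp only: linear_cosum[OF linear_mul_left]) (subst cosum_swap[of _ b], rule refl)
  \<comment> \<open>Coassociativity, here in \<open>a\<close> and below in \<open>b\<close>,
    regroups the legs until \<open>x \<odot> u\<close> and \<open>p \<odot> m\<close> are the two
    legs of one product \<open>z \<odot> w\<close>.\<close>
  also have "\<dots> = cosum (\<lambda>z q. cosum (\<lambda>x p. cosum (\<lambda>u v. S (x \<odot> u) \<odot> (p \<odot> E v \<odot> S q)) b) z) a"
    by (rule cosum_coassoc[where s = scale, symmetric]) (intro multilinear)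
  also have "\<dots> = cosum (\<lambda>z q. cosum (\<lambda>x p. cosum (\<lambda>u v. cosum (\<lambda>m n. S (x \<odot> u) \<odot> (p \<odot> (m \<odot> S n) \<odot> S q)) v) b) z) a"
    by (simp only: cosum_id_S[symmetric] linear_cosum[OF linear_mul_left]
        linear_cosum[OF linear_mul_right])
  also have "\<dots> = cosum (\<lambda>z q. cosum (\<lambda>x p. cosum (\<lambda>w n. cosum (\<lambda>u m. S (x \<odot> u) \<odot> (p \<odot> (m \<odot> S n) \<odot> S q)) w) b) z) a"
    by (subst cosum_coassoc[where s = scale and a = b]) (auto intro!: multilinear)
  also have "\<dots> = cosum (\<lambda>z q. cosum (\<lambda>w n. cosum (\<lambda>x p. cosum (\<lambda>u m. S (x \<odot> u) \<odot> (p \<odot> m)) w) z \<odot> (S n \<odot> S q)) b) a"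
    by (subst cosum_swap[of _ b]) (simp only: linear_cosum[OF linear_mul_right] mul_assoc)
  \<comment> \<open>These legs contract to \<open>F (z \<odot> w)\<close>, which monoidality turns
    into \<open>F (F z \<odot> w)\<close>.\<close>
  also have "\<dots> = cosum (\<lambda>z q. cosum (\<lambda>w n. F (F z \<odot> w) \<odot> (S n \<odot> S q)) b) a"
    by (subst cosum_mul[where s = scale, symmetric])
      (auto intro!: multilinear simp: cosum_S_id simp flip: scounit_mul)
  also have "\<dots> = cosum (\<lambda>z q. cosum (\<lambda>w n. cosum (\<lambda>u v. S u \<odot> F z \<odot> v \<odot> (S n \<odot> S q)) w) b) a"
    by (simp only: scounit_scounit_mul linear_cosum[OF linear_mul_right])
  also have "\<dots> = cosum (\<lambda>z q. cosum (\<lambda>u w. cosum (\<lambda>v n. S u \<odot> F z \<odot> v \<odot> (S n \<odot> S q)) w) b) a"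
    by (subst cosum_coassoc[where s = scale and a = b]) (auto intro!: multilinear)
  also have "\<dots> = cosum (\<lambda>z q. cosum (\<lambda>u w. S u \<odot> (F z \<odot> E w) \<odot> S q) b) a"
    by (simp only: cosum_id_S[symmetric] linear_cosum[OF linear_mul_left]
        linear_cosum[OF linear_mul_right] mul_assoc)
  \<comment> \<open>Commuting \<open>F z\<close> past \<open>E w\<close> separates the factors from
    \<open>b\<close> and from \<open>a\<close>; each of the two sums is a contracted antipode
    law.\<close>
  also have "\<dots> = cosum (\<lambda>z q. cosum (\<lambda>u w. S u \<odot> E w) b \<odot> (F z \<odot> S q)) a"
    by (simp only: tcounit_scounit_commute[symmetric] linear_cosum[OF linear_mul_right] mul_assoc)
  also have "\<dots> = S b \<odot> S a"
    by (simp only: S_eq linear_cosum[OF linear_mul_left, symmetric] S_eq')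
  finally show "S (a \<odot> b) = S b \<odot> S a" .
qed

lemma anti_multiplicative_iff: "anti_multiplicative S \<longleftrightarrow> monoidal \<and> antipode S"
  using antipode_if_anti_multiplicative monoidal_if_anti_multiplicative
    anti_multiplicative_if_antipode by blast

end

section \<open>The dual weak bialgebra\<close>

context fin_dim_space
begin

definition basis :: "'a set"
  where "basis = (SOME B. finite B \<and> independent B \<and> span B = UNIV)"

lemma basis: "finite basis" "independent basis" "span basis = UNIV"
proof -
  obtain B where "finite_dimensional_vector_space scale B" by (rule finite_dimensional)
  then interpret V: finite_dimensional_vector_space scale B .
  have "\<exists>B. finite B \<and> independent B \<and> span B = UNIV"
    using V.finite_Basis V.independent_Basis V.span_Basis by blast
  from someI_ex[OF this] show "finite basis" "independent basis" "span basis = UNIV"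
    unfolding basis_def by blast+
qed

text \<open>The form depends only on \<open>scale\<close> and the chosen basis, so an algebra and
  its dual on the same space share it.\<close>

definition form :: "'a \<Rightarrow> 'a \<Rightarrow> 'k" (\<open>\<langle>_, _\<rangle>\<close>)
  where "\<langle>x, y\<rangle> = (\<Sum>b\<in>basis. representation basis x b * representation basis y b)"

lemma form_commute: "\<langle>x, y\<rangle> = \<langle>y, x\<rangle>"
  by (simp add: form_def mult.commute)

lemma form_linear_right: "lin scale (*) (\<lambda>x. \<langle>y, x\<rangle>)"
  by (simp add: Vector_Spaces.linear_iff vector_space_scale vector_space_mult form_def basis
      representation_add representation_scale sum.distrib sum_distrib_left algebra_simps)

lemma form_multilinear [multilinear]:
  "lin r scale g \<Longrightarrow> lin r (*) (\<lambda>x. \<langle>y, g x\<rangle>)"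
  "lin r scale g \<Longrightarrow> lin r (*) (\<lambda>x. \<langle>g x, y\<rangle>)"
  using linear_comp[OF form_linear_right] by (simp_all add: form_commute[of _ y])

lemma form_expand: "(\<Sum>b\<in>basis. \<langle>x, b\<rangle> \<cdot> b) = x"
proof -
  have "\<langle>x, b\<rangle> = representation basis x b" if "b \<in> basis" for b
  proof -
    have "\<langle>x, b\<rangle> = (\<Sum>c\<in>basis. if c = b then representation basis x c else 0)"
      unfolding form_def representation_basis[OF basis(2) that] by (intro sum.cong) auto
    then show ?thesis using that by (simp add: basis(1))
  qed
  then have "(\<Sum>b\<in>basis. \<langle>x, b\<rangle> \<cdot> b) = (\<Sum>b\<in>basis. representation basis x b \<cdot> b)"
    by (intro sum.cong) auto
  also have "\<dots> = x"
    by (rule sum_representation_eq[OF basis(2) _ basis(1) order_refl]) (simp add: basis(3))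
  finally show ?thesis .
qed

lemma form_eqI:
  assumes "\<And>w. \<langle>x, w\<rangle> = \<langle>y, w\<rangle>"
  shows "x = y"
proof -
  have "x = (\<Sum>b\<in>basis. \<langle>x, b\<rangle> \<cdot> b)" by (rule form_expand[symmetric])
  also have "\<dots> = y" unfolding assms by (rule form_expand)
  finally show ?thesis .
qed

lemma form_eqI': "(\<And>w. \<langle>w, x\<rangle> = \<langle>w, y\<rangle>) \<Longrightarrow> x = y"
  by (rule form_eqI) (metis form_commute)

text \<open>Additivity and homogeneity are equations between vectors, hence can be tested against
  every \<open>w\<close>. This suits maps defined through \<open>riesz\<close>.\<close>

lemma linear_by_form:
  assumes "\<And>w. lin scale (*) (\<lambda>x. \<langle>g x, w\<rangle>)"
  shows "lin scale scale g"
proof -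
  have "\<langle>x + y, w\<rangle> = \<langle>x, w\<rangle> + \<langle>y, w\<rangle>" "\<langle>c \<cdot> x, w\<rangle> = c * \<langle>x, w\<rangle>" for x y c w
    using form_linear_right[of w] by (simp_all add: Vector_Spaces.linear_iff form_commute[of _ w])
  then show ?thesis
    using assms unfolding Vector_Spaces.linear_iff
    by (intro conjI allI vector_space_scale form_eqI) (simp_all only:)
qed

lemma functional_expand:
  assumes "lin scale (*) \<phi>"
  shows "(\<Sum>b\<in>basis. \<phi> b * \<langle>b, x\<rangle>) = \<phi> x"
proof -
  interpret L: Vector_Spaces.linear scale "(*)" \<phi> by fact
  have "\<phi> x = \<phi> (\<Sum>b\<in>basis. \<langle>x, b\<rangle> \<cdot> b)" by (simp add: form_expand)
  also have "\<dots> = (\<Sum>b\<in>basis. \<phi> b * \<langle>b, x\<rangle>)"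
    unfolding L.sum L.scale by (intro sum.cong refl) (metis mult.commute form_commute)
  finally show ?thesis ..
qed

definition riesz :: "('a \<Rightarrow> 'k) \<Rightarrow> 'a"
  where "riesz \<phi> = (\<Sum>b\<in>basis. \<phi> b \<cdot> b)"

lemma form_riesz:
  assumes "lin scale (*) \<phi>"
  shows "\<langle>riesz \<phi>, w\<rangle> = \<phi> w"
proof -
  interpret L: Vector_Spaces.linear scale "(*)" "\<lambda>x. \<langle>x, w\<rangle>" by (intro multilinear)
  show ?thesis
    by (simp add: riesz_def L.sum L.scale functional_expand[OF assms])
qed

lemma bilinear_expand:
  assumes \<beta>: "bilinear_to (*) \<beta>"
  shows "(\<Sum>b\<in>basis. \<Sum>c\<in>basis. \<beta> b c * (\<langle>b, x\<rangle> * \<langle>c, y\<rangle>)) = \<beta> x y"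
proof -
  have "(\<Sum>b\<in>basis. \<Sum>c\<in>basis. \<beta> b c * (\<langle>b, x\<rangle> * \<langle>c, y\<rangle>)) =
    (\<Sum>b\<in>basis. (\<Sum>c\<in>basis. \<beta> b c * \<langle>c, y\<rangle>) * \<langle>b, x\<rangle>)"
    by (simp add: sum_distrib_left sum_distrib_right mult_ac)
  also have "\<dots> = (\<Sum>b\<in>basis. \<beta> b y * \<langle>b, x\<rangle>)"
    by (subst functional_expand) (auto intro!: multilinear bilinear_to_comp[OF \<beta>])
  also have "\<dots> = \<beta> x y"
    by (rule functional_expand) (intro multilinear bilinear_to_comp[OF \<beta>])
  finally show ?thesis .
qed

lemma trilinear_expand:
  assumes \<tau>: "trilinear_to (*) \<tau>"
  shows "(\<Sum>b\<in>basis. \<Sum>c\<in>basis. \<Sum>d\<in>basis. \<tau> b c d * (\<langle>b, x\<rangle> * \<langle>c, y\<rangle> * \<langle>d, z\<rangle>)) = \<tau> x y z"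
proof -
  have "(\<Sum>b\<in>basis. \<Sum>c\<in>basis. \<Sum>d\<in>basis. \<tau> b c d * (\<langle>b, x\<rangle> * \<langle>c, y\<rangle> * \<langle>d, z\<rangle>)) =
    (\<Sum>b\<in>basis. (\<Sum>c\<in>basis. \<Sum>d\<in>basis. \<tau> b c d * (\<langle>c, y\<rangle> * \<langle>d, z\<rangle>)) * \<langle>b, x\<rangle>)"
    by (simp add: sum_distrib_left sum_distrib_right mult_ac)
  also have "\<dots> = (\<Sum>b\<in>basis. \<tau> b y z * \<langle>b, x\<rangle>)"
    by (subst bilinear_expand) (auto intro!: multilinear trilinear_to_comp[OF \<tau>])
  also have "\<dots> = \<tau> x y z"
    by (rule functional_expand) (intro multilinear trilinear_to_comp[OF \<tau>])
  finally show ?thesis .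
qed

lemma product_form_bilinear: "bilinear_to (*) (\<lambda>x y. \<langle>x, p\<rangle> * \<langle>y, q\<rangle>)"
  by (intro multilinear)

lemma product_form_trilinear: "trilinear_to (*) (\<lambda>x y z. \<langle>x, p\<rangle> * \<langle>y, q\<rangle> * \<langle>z, r\<rangle>)"
  by (intro multilinear)

text \<open>Products of two functionals given by basis vectors span the bilinear forms, and
  evaluation of a tensor is linear on these. A tensor is therefore determined by its values at such
  products.\<close>

lemma tensor_square_expand:
  assumes "t \<in> tensor_square" and \<beta>: "bilinear_to (*) \<beta>"
  shows "t \<beta> = (\<Sum>b\<in>basis. \<Sum>c\<in>basis. \<beta> b c * t (\<lambda>x y. \<langle>x, b\<rangle> * \<langle>y, c\<rangle>))"
proof -
  obtain ps where t: "t = (\<Sum>(x, y)\<leftarrow>ps. x \<otimes> y)"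
    using assms(1) by (auto simp: tensor_square_def)
  have "(\<Sum>(x, y)\<leftarrow>ps. x \<otimes> y) \<beta> =
      (\<Sum>b\<in>basis. \<Sum>c\<in>basis. \<beta> b c * (\<Sum>(x, y)\<leftarrow>ps. x \<otimes> y) (\<lambda>x y. \<langle>x, b\<rangle> * \<langle>y, c\<rangle>))"
  proof (induction ps)
    case (Cons p ps)
    then show ?case
      using bilinear_expand[OF \<beta>, of "fst p" "snd p", symmetric]
      by (simp add: tens2_def \<beta> product_form_bilinear split_def distrib_left sum.distrib
          form_commute[of "fst p"] form_commute[of "snd p"])
  qed simp
  then show ?thesis unfolding t .
qed

lemma tensor_cube_expand:
  assumes "t \<in> tensor_cube" and \<tau>: "trilinear_to (*) \<tau>"
  shows "t \<tau> = (\<Sum>b\<in>basis. \<Sum>c\<in>basis. \<Sum>d\<in>basis.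
    \<tau> b c d * t (\<lambda>x y z. \<langle>x, b\<rangle> * \<langle>y, c\<rangle> * \<langle>z, d\<rangle>))"
proof -
  obtain ps where t: "t = (\<Sum>(x, y, z)\<leftarrow>ps. x \<otimes> y \<otimes> z)"
    using assms(1) by (auto simp: tensor_cube_def)
  have "(\<Sum>(x, y, z)\<leftarrow>ps. x \<otimes> y \<otimes> z) \<tau> = (\<Sum>b\<in>basis. \<Sum>c\<in>basis. \<Sum>d\<in>basis.
      \<tau> b c d * (\<Sum>(x, y, z)\<leftarrow>ps. x \<otimes> y \<otimes> z) (\<lambda>x y z. \<langle>x, b\<rangle> * \<langle>y, c\<rangle> * \<langle>z, d\<rangle>))"
  proof (induction ps)
    case (Cons p ps)
    then show ?case
      using trilinear_expand[OF \<tau>, of "fst p" "fst (snd p)" "snd (snd p)", symmetric]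
      by (simp add: tens3_def \<tau> product_form_trilinear split_def distrib_left sum.distrib
          form_commute[of "fst p"] form_commute[of "fst (snd p)"] form_commute[of "snd (snd p)"])
  qed simp
  then show ?thesis unfolding t .
qed

lemma tensor_square_eqI:
  assumes "t \<in> tensor_square" "u \<in> tensor_square"
    and "\<And>p q. t (\<lambda>x y. \<langle>x, p\<rangle> * \<langle>y, q\<rangle>) = u (\<lambda>x y. \<langle>x, p\<rangle> * \<langle>y, q\<rangle>)"
  shows "t = u"
proof
  fix \<beta> show "t \<beta> = u \<beta>"
    by (cases "bilinear_to (*) \<beta>")
      (simp_all add: tensor_square_not_bilinear tensor_square_expand assms)
qed

lemma tensor_cube_eqI:
  assumes "t \<in> tensor_cube" "u \<in> tensor_cube"
    and "\<And>p q r. t (\<lambda>x y z. \<langle>x, p\<rangle> * \<langle>y, q\<rangle> * \<langle>z, r\<rangle>) = u (\<lambda>x y z. \<langle>x, p\<rangle> * \<langle>y, q\<rangle> * \<langle>z, r\<rangle>)"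
  shows "t = u"
proof
  fix \<tau> show "t \<tau> = u \<tau>"
    by (cases "trilinear_to (*) \<tau>")
      (simp_all add: tensor_cube_not_trilinear tensor_cube_expand assms)
qed

end

context coproduct_space
begin

lemma cosum_mult:
  "c * cosum f a = cosum (\<lambda>x y. (c :: 'k) * f x y) a"
  "cosum f a * c = cosum (\<lambda>x y. f x y * (c :: 'k)) a"
  by (simp_all add: cosum_def sum_list_const_mult sum_list_mult_const split_def)

end

section \<open>Axioms tested by the form, and the dual structure maps\<close>

context weak_bialgebra
begin

text \<open>All tensors involved lie in the tensor cube, so products of three functionals detect
  equality. In this shape the condition can be matched with monoidality of the dual.\<close>

lemma comonoidal_iff_form:
  "comonoidal \<longleftrightarrow> (\<forall>p q r.
    cosum (\<lambda>x y. cosum (\<lambda>u v. \<langle>x, p\<rangle> * \<langle>y \<odot> u, q\<rangle> * \<langle>v, r\<rangle>) \<one>) \<one> =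
      cosum (\<lambda>x z. cosum (\<lambda>u v. \<langle>u, p\<rangle> * \<langle>v, q\<rangle> * \<langle>z, r\<rangle>) x) \<one> \<and>
    cosum (\<lambda>x z. cosum (\<lambda>u v. \<langle>u, p\<rangle> * \<langle>v, q\<rangle> * \<langle>z, r\<rangle>) x) \<one> =
      cosum (\<lambda>u v. cosum (\<lambda>x y. \<langle>x, p\<rangle> * \<langle>u \<odot> y, q\<rangle> * \<langle>v, r\<rangle>) \<one>) \<one>)"
proof -
  have *: "t = u \<longleftrightarrow> (\<forall>p q r. t (\<lambda>x y z. \<langle>x, p\<rangle> * \<langle>y, q\<rangle> * \<langle>z, r\<rangle>) =
    u (\<lambda>x y z. \<langle>x, p\<rangle> * \<langle>y, q\<rangle> * \<langle>z, r\<rangle>))" if "t \<in> tensor_cube" "u \<in> tensor_cube" for t u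
    using tensor_cube_eqI[OF that] by blast
  show ?thesis
    unfolding comonoidal_def comul3_def mul3_unit_left_right mul3_unit_right_left comul_id_eq
    by (subst (1 2) *; (intro cosum_in_cube tens3_in_cube)?)
      (auto simp: cosum_apply tens3_def product_form_trilinear)
qed

lemma anti_comultiplicative_iff_form:
  assumes S: "lin scale scale S"
  shows "anti_comultiplicative S \<longleftrightarrow> (\<forall>a p q. cosum (\<lambda>x y. \<langle>x, p\<rangle> * \<langle>y, q\<rangle>) (S a) =
    cosum (\<lambda>x y. \<langle>S y, p\<rangle> * \<langle>S x, q\<rangle>) a)"
proof -
  have 1: "sweedler2 (\<lambda>x y. S y \<otimes> S x) (\<Delta> a) = cosum (\<lambda>x y. S y \<otimes> S x) a" for a
    by (rule sweedler2_comul[of pointwise_scale]) (intro multilinear linear_comp[OF S])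
  have *: "t = u \<longleftrightarrow> (\<forall>p q. t (\<lambda>x y. \<langle>x, p\<rangle> * \<langle>y, q\<rangle>) = u (\<lambda>x y. \<langle>x, p\<rangle> * \<langle>y, q\<rangle>))"
    if "t \<in> tensor_square" "u \<in> tensor_square" for t u
    using tensor_square_eqI[OF that] by blast
  have "\<Delta> (S a) = cosum (\<lambda>x y. S y \<otimes> S x) a \<longleftrightarrow> (\<forall>p q. cosum (\<lambda>x y. \<langle>x, p\<rangle> * \<langle>y, q\<rangle>) (S a) =
    cosum (\<lambda>x y. \<langle>S y, p\<rangle> * \<langle>S x, q\<rangle>) a)" for a
    using *[OF comul_tensor cosum_in_square[OF tens2_in_square]]
    by (simp add: comul_apply product_form_bilinear cosum_apply tens2_def)
  then show ?thesis
    unfolding anti_comultiplicative_def 1 by simp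
qed

text \<open>
  The dual weak bialgebra lives on the same space: functionals are identified with vectors by the
  symmetric form for which \<open>basis\<close> is orthonormal.
\<close>

definition dual_mul :: "'a \<Rightarrow> 'a \<Rightarrow> 'a"
  where "dual_mul x y = riesz (cosum (\<lambda>u v. \<langle>x, u\<rangle> * \<langle>y, v\<rangle>))"

definition dual_unit :: 'a
  where "dual_unit = riesz \<epsilon>"

text \<open>The transpose of the multiplication. The scalar is put into the first factor so that
  each summand is a pure tensor.\<close>

definition dual_comul :: "'a \<Rightarrow> ('k, 'a) tensor2"
  where "dual_comul x = (\<Sum>b\<in>basis. \<Sum>c\<in>basis. (\<langle>x, b \<odot> c\<rangle> \<cdot> b) \<otimes> c)"

definition dual_counit :: "'a \<Rightarrow> 'k"
  where "dual_counit x = \<langle>x, \<one>\<rangle>"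

definition dual_map :: "('a \<Rightarrow> 'a) \<Rightarrow> 'a \<Rightarrow> 'a"
  where "dual_map S x = riesz (\<lambda>w. \<langle>x, S w\<rangle>)"

lemma form_cosum: "\<langle>a, cosum f w\<rangle> = cosum (\<lambda>x y. \<langle>a, f x y\<rangle>) w"
  by (rule linear_cosum[OF form_linear_right])

lemma form_dual_mul: "\<langle>dual_mul x y, w\<rangle> = cosum (\<lambda>u v. \<langle>x, u\<rangle> * \<langle>y, v\<rangle>) w"
  unfolding dual_mul_def by (rule form_riesz) (intro multilinear)

lemma form_dual_unit: "\<langle>dual_unit, w\<rangle> = \<epsilon> w"
  unfolding dual_unit_def by (rule form_riesz[OF counit_linear])

lemma form_dual_map:
  assumes "lin scale scale S"
  shows "\<langle>dual_map S x, w\<rangle> = \<langle>x, S w\<rangle>"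
  unfolding dual_map_def by (rule form_riesz) (intro multilinear linear_comp[OF assms])

lemma dual_coproduct_space: "coproduct_space scale dual_comul"
proof (intro coproduct_space.intro coproduct_space_axioms.intro tensor_space_axioms)
  show "dual_comul x \<in> tensor_square" for x
    unfolding dual_comul_def by (intro tensor_square_sum tens2_in_square)
  have "lin scale pointwise_scale (\<lambda>x. (\<langle>x, b \<odot> c\<rangle> \<cdot> b) \<otimes> c)" for b c
    by (intro multilinear)
  then show "lin scale pointwise_scale dual_comul"
    unfolding Vector_Spaces.linear_iff dual_comul_def
    by (auto simp: fun_eq_iff pointwise_scale_def sum_fun_apply sum_distrib_left
        simp flip: sum.distrib)
qed

lemma dual_comul_apply:
  "dual_comul x (\<lambda>u v. \<langle>u, p\<rangle> * \<langle>v, q\<rangle>) = \<langle>x, p \<odot> q\<rangle>"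
proof -
  have "\<langle>\<langle>x, b \<odot> c\<rangle> \<cdot> b, p\<rangle> = \<langle>x, b \<odot> c\<rangle> * \<langle>b, p\<rangle>" for b c
    by (rule linear_scale_apply) (intro multilinear)
  then have "dual_comul x (\<lambda>u v. \<langle>u, p\<rangle> * \<langle>v, q\<rangle>) =
      (\<Sum>b\<in>basis. \<Sum>c\<in>basis. \<langle>x, b \<odot> c\<rangle> * (\<langle>b, p\<rangle> * \<langle>c, q\<rangle>))"
    by (simp add: dual_comul_def sum_fun_apply tens2_def product_form_bilinear mult.assoc)
  also have "\<dots> = \<langle>x, p \<odot> q\<rangle>"
    by (rule bilinear_expand) (intro multilinear)
  finally show ?thesis .
qed

abbreviation dual_cosum :: "('a \<Rightarrow> 'a \<Rightarrow> 'v::ab_group_add) \<Rightarrow> 'a \<Rightarrow> 'v"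
  where "dual_cosum \<equiv> coproduct_space.cosum scale dual_comul"

lemma dual_cosum_form: "dual_cosum (\<lambda>u v. \<langle>u, p\<rangle> * \<langle>v, q\<rangle>) x = \<langle>x, p \<odot> q\<rangle>"
proof -
  interpret D: coproduct_space scale dual_comul by (rule dual_coproduct_space)
  show ?thesis
    by (simp add: D.comul_apply[symmetric] product_form_bilinear dual_comul_apply)
qed

text \<open>Both sums are finite, so they can be exchanged. In the dual computations the inner sums
  then contract by \<open>dual_cosum_form\<close>.\<close>

lemma dual_cosum_swap:
  "dual_cosum (\<lambda>x y. cosum (\<lambda>u v. f x y u v) b) a = cosum (\<lambda>u v. dual_cosum (\<lambda>x y. f x y u v) a) b"
proof -
  interpret D: coproduct_space scale dual_comul by (rule dual_coproduct_space)
  show ?thesis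
    unfolding cosum_def D.cosum_def split_def by (rule sum_list_commute)
qed

section \<open>Axioms of the dual, and the meaning of its monoidality and comonoidality\<close>

lemma dual_fin_dim_algebra: "fin_dim_algebra scale dual_mul dual_unit"
proof unfold_locales
  show "\<exists>B. finite B \<and> span B = UNIV" by (rule finite_dim)
  show "bilinear_to scale dual_mul"
    by (intro bilinear_toI linear_by_form; unfold form_dual_mul; intro multilinear)
  fix a b c
  \<comment> \<open>Paired with \<open>w\<close>, this is coassociativity of
    \<open>\<Delta>\<close>.\<close>
  show "dual_mul (dual_mul a b) c = dual_mul a (dual_mul b c)"
  proof (rule form_eqI)
    fix w
    have "\<langle>dual_mul (dual_mul a b) c, w\<rangle> =
        cosum (\<lambda>x z. cosum (\<lambda>u v. \<langle>a, u\<rangle> * (\<langle>b, v\<rangle> * \<langle>c, z\<rangle>)) x) w"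
      by (simp add: form_dual_mul cosum_mult mult.assoc)
    also have "\<dots> = cosum (\<lambda>x z. cosum (\<lambda>u v. \<langle>a, x\<rangle> * (\<langle>b, u\<rangle> * \<langle>c, v\<rangle>)) z) w"
      by (rule cosum_coassoc[where s = "(*)"]) (intro multilinear)
    also have "\<dots> = \<langle>dual_mul a (dual_mul b c), w\<rangle>"
      by (simp add: form_dual_mul cosum_mult)
    finally show "\<langle>dual_mul (dual_mul a b) c, w\<rangle> = \<langle>dual_mul a (dual_mul b c), w\<rangle>" .
  qed
  have l: "lin scale (*) (\<lambda>x. \<langle>a, x\<rangle>)" by (intro multilinear)
  show "dual_mul dual_unit a = a"
    by (rule form_eqI) (simp add: form_dual_mul form_dual_unit cosum_counit_left[OF l])
  show "dual_mul a dual_unit = a"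
    using cosum_counit_right[OF l]
    by (intro form_eqI) (simp add: form_dual_mul form_dual_unit mult.commute)
qed

lemma dual_algebra_coproduct: "algebra_coproduct scale dual_mul dual_unit dual_comul"
  by (intro algebra_coproduct.intro dual_fin_dim_algebra dual_coproduct_space)

lemma dual_weak_bialgebra:
  "weak_bialgebra scale dual_mul dual_unit dual_comul dual_counit"
proof -
  interpret D: algebra_coproduct scale dual_mul dual_unit dual_comul
    by (rule dual_algebra_coproduct)
  show ?thesis
  proof (intro weak_bialgebra.intro coalgebra.intro coalgebra_axioms.intro
      weak_bialgebra_axioms.intro dual_fin_dim_algebra dual_coproduct_space)
    show "lin scale (*) dual_counit"
      unfolding dual_counit_def by (intro multilinear)
    fix a b
    \<comment> \<open>Tested against three vectors, this is associativity of the product.\<close>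
    show "D.comul_id (dual_comul a) = D.id_comul (dual_comul a)"
    proof (rule tensor_cube_eqI[OF D.comul_id_in_cube D.id_comul_in_cube])
      fix p q r
      have "dual_cosum (\<lambda>x z. dual_cosum (\<lambda>u v. \<langle>u, p\<rangle> * \<langle>v, q\<rangle> * \<langle>z, r\<rangle>) x) a = \<langle>a, p \<odot> q \<odot> r\<rangle>"
        by (simp only: D.cosum_mult[symmetric] dual_cosum_form)
      moreover have "dual_cosum (\<lambda>x z. dual_cosum (\<lambda>u v. \<langle>x, p\<rangle> * \<langle>u, q\<rangle> * \<langle>v, r\<rangle>) z) a = \<langle>a, p \<odot> (q \<odot> r)\<rangle>"
        by (simp only: D.cosum_mult[symmetric] dual_cosum_form mult.assoc)
      ultimately show "D.comul_id (dual_comul a) (\<lambda>x y z. \<langle>x, p\<rangle> * \<langle>y, q\<rangle> * \<langle>z, r\<rangle>) =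
          D.id_comul (dual_comul a) (\<lambda>x y z. \<langle>x, p\<rangle> * \<langle>y, q\<rangle> * \<langle>z, r\<rangle>)"
        by (simp add: D.comul_id_apply D.id_comul_apply product_form_trilinear mul_assoc)
    qed
    show "sweedler2 (\<lambda>x y. dual_counit x \<cdot> y) (dual_comul a) = a"
    proof (rule form_eqI)
      fix w
      have l: "lin scale (*) (\<lambda>x. \<langle>x, w\<rangle>)" by (intro multilinear)
      show "\<langle>sweedler2 (\<lambda>x y. dual_counit x \<cdot> y) (dual_comul a), w\<rangle> = \<langle>a, w\<rangle>"
        unfolding dual_counit_def
        by (subst D.sweedler2_comul[of scale])
          (auto intro!: multilinear simp: D.linear_cosum[OF l] linear_scale_apply[OF l]
            dual_cosum_form unit_left)
    qed
    show "sweedler2 (\<lambda>x y. dual_counit y \<cdot> x) (dual_comul a) = a"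
    proof (rule form_eqI)
      fix w
      have l: "lin scale (*) (\<lambda>x. \<langle>x, w\<rangle>)" by (intro multilinear)
      show "\<langle>sweedler2 (\<lambda>x y. dual_counit y \<cdot> x) (dual_comul a), w\<rangle> = \<langle>a, w\<rangle>"
        unfolding dual_counit_def
        by (subst D.sweedler2_comul[of scale])
          (auto intro!: multilinear simp: D.linear_cosum[OF l] linear_scale_apply[OF l]
            mult.commute[of _ "\<langle>_, w\<rangle>"] dual_cosum_form unit_right)
    qed
    \<comment> \<open>Multiplicativity of the coproduct is self-dual: tested against
      \<open>p\<close> and \<open>q\<close>, both sides evaluate \<open>a\<close> and
      \<open>b\<close> on the legs of \<open>p \<odot> q\<close>.\<close>
    show "dual_comul (dual_mul a b) = D.mul2 (dual_comul a) (dual_comul b)"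
    proof (rule tensor_square_eqI[OF D.comul_tensor D.mul2_comul_in_square])
      fix p q
      have "D.mul2 (dual_comul a) (dual_comul b) (\<lambda>x y. \<langle>x, p\<rangle> * \<langle>y, q\<rangle>) =
        dual_cosum (\<lambda>x y. dual_cosum (\<lambda>x' y'.
          cosum (\<lambda>q1 q2. \<langle>y, q1\<rangle> * \<langle>y', q2\<rangle>) q * cosum (\<lambda>p1 p2. \<langle>x, p1\<rangle> * \<langle>x', p2\<rangle>) p) b) a"
        by (simp add: D.mul2_comul_apply product_form_bilinear form_dual_mul mult.commute)
      also have "\<dots> = dual_cosum (\<lambda>x y. dual_cosum (\<lambda>x' y'. cosum (\<lambda>p1 p2. cosum (\<lambda>q1 q2.
          (\<langle>x, p1\<rangle> * \<langle>y, q1\<rangle>) * (\<langle>x', p2\<rangle> * \<langle>y', q2\<rangle>)) q) p) b) a"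
        by (simp only: cosum_mult(1), simp only: cosum_mult(2), simp only: mult_ac)
      also have "\<dots> = cosum (\<lambda>p1 p2. cosum (\<lambda>q1 q2.
          dual_cosum (\<lambda>x y. \<langle>x, p1\<rangle> * \<langle>y, q1\<rangle>) a * dual_cosum (\<lambda>x' y'. \<langle>x', p2\<rangle> * \<langle>y', q2\<rangle>) b) q) p"
        by (simp only: dual_cosum_swap D.cosum_mult[symmetric])
      also have "\<dots> = cosum (\<lambda>p1 p2. cosum (\<lambda>q1 q2. \<langle>a, p1 \<odot> q1\<rangle> * \<langle>b, p2 \<odot> q2\<rangle>) q) p"
        by (simp only: dual_cosum_form)
      also have "\<dots> = cosum (\<lambda>u v. \<langle>a, u\<rangle> * \<langle>b, v\<rangle>) (p \<odot> q)"
        by (rule cosum_mul[where s = "(*)", symmetric]) (intro multilinear)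
      also have "\<dots> = dual_comul (dual_mul a b) (\<lambda>x y. \<langle>x, p\<rangle> * \<langle>y, q\<rangle>)"
        by (simp add: dual_comul_apply form_dual_mul)
      finally show "dual_comul (dual_mul a b) (\<lambda>x y. \<langle>x, p\<rangle> * \<langle>y, q\<rangle>) =
        D.mul2 (dual_comul a) (dual_comul b) (\<lambda>x y. \<langle>x, p\<rangle> * \<langle>y, q\<rangle>)" ..
    qed
  qed
qed

text \<open>The dual counit of a triple product evaluates the iterated coproduct of
  \<open>\<one>\<close>; the products of two dual counits evaluate the two products formed from
  copies of \<open>\<Delta> \<one>\<close>.\<close>

lemma dual_monoidal_iff:
  "weak_bialgebra.monoidal scale dual_mul dual_comul dual_counit \<longleftrightarrow> comonoidal"
proof -
  interpret D: weak_bialgebra scale dual_mul dual_unit dual_comul dual_counit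
    by (rule dual_weak_bialgebra)
  have 0: "dual_counit (dual_mul (dual_mul p q) r) =
      cosum (\<lambda>x z. cosum (\<lambda>u v. \<langle>u, p\<rangle> * \<langle>v, q\<rangle> * \<langle>z, r\<rangle>) x) \<one>" for p q r
    by (simp only: dual_counit_def form_dual_mul cosum_mult) (simp only: form_commute)
  have 1: "D.cosum (\<lambda>x y. dual_counit (dual_mul p x) * dual_counit (dual_mul y r)) q =
      cosum (\<lambda>x y. cosum (\<lambda>u v. \<langle>x, p\<rangle> * \<langle>y \<odot> u, q\<rangle> * \<langle>v, r\<rangle>) \<one>) \<one>" for p q r
  proof -
    have "D.cosum (\<lambda>x y. dual_counit (dual_mul p x) * dual_counit (dual_mul y r)) q =
        D.cosum (\<lambda>x y. cosum (\<lambda>m n. cosum (\<lambda>u v. (\<langle>p, m\<rangle> * (\<langle>x, n\<rangle> * \<langle>y, u\<rangle>)) * \<langle>r, v\<rangle>) \<one>) \<one>) q"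
      by (simp only: dual_counit_def form_dual_mul cosum_mult(2), simp only: cosum_mult(1))
        (simp only: mult_ac)
    also have "\<dots> = cosum (\<lambda>m n. cosum (\<lambda>u v. \<langle>p, m\<rangle> * \<langle>q, n \<odot> u\<rangle> * \<langle>r, v\<rangle>) \<one>) \<one>"
      by (simp only: dual_cosum_swap D.cosum_mult[symmetric] dual_cosum_form)
    finally show ?thesis by (simp add: form_commute)
  qed
  have 2: "D.cosum (\<lambda>x y. dual_counit (dual_mul p y) * dual_counit (dual_mul x r)) q =
      cosum (\<lambda>u v. cosum (\<lambda>x y. \<langle>x, p\<rangle> * \<langle>u \<odot> y, q\<rangle> * \<langle>v, r\<rangle>) \<one>) \<one>" for p q r
  proof -
    have "D.cosum (\<lambda>x y. dual_counit (dual_mul p y) * dual_counit (dual_mul x r)) q =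
        D.cosum (\<lambda>x y. cosum (\<lambda>u v. cosum (\<lambda>m n. (\<langle>p, m\<rangle> * (\<langle>x, u\<rangle> * \<langle>y, n\<rangle>)) * \<langle>r, v\<rangle>) \<one>) \<one>) q"
      by (simp only: dual_counit_def form_dual_mul cosum_mult(1), simp only: cosum_mult(2))
        (simp only: mult_ac)
    also have "\<dots> = cosum (\<lambda>u v. cosum (\<lambda>m n. \<langle>p, m\<rangle> * \<langle>q, u \<odot> n\<rangle> * \<langle>r, v\<rangle>) \<one>) \<one>"
      by (simp only: dual_cosum_swap D.cosum_mult[symmetric] dual_cosum_form)
    finally show ?thesis by (simp add: form_commute)
  qed
  show ?thesis
    unfolding D.monoidal_iff comonoidal_iff_form 0 1 2 by metis
qed

text \<open>The vector \<open>dual_unit\<close> represents \<open>\<epsilon>\<close>, so its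
  coproducts, paired with vectors, become counits of products.\<close>

lemma dual_comonoidal_iff:
  "weak_bialgebra.comonoidal scale dual_mul dual_unit dual_comul \<longleftrightarrow> monoidal"
proof -
  interpret D: weak_bialgebra scale dual_mul dual_unit dual_comul dual_counit
    by (rule dual_weak_bialgebra)
  have 0: "D.cosum (\<lambda>x z. D.cosum (\<lambda>u v. \<langle>u, p\<rangle> * \<langle>v, q\<rangle> * \<langle>z, r\<rangle>) x) dual_unit = \<epsilon> (p \<odot> q \<odot> r)"
    for p q r
    by (simp only: D.cosum_mult[symmetric] dual_cosum_form form_dual_unit)
  have 1: "D.cosum (\<lambda>x y. D.cosum (\<lambda>u v. \<langle>x, p\<rangle> * \<langle>dual_mul y u, q\<rangle> * \<langle>v, r\<rangle>) dual_unit) dual_unit =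
      cosum (\<lambda>x y. \<epsilon> (p \<odot> x) * \<epsilon> (y \<odot> r)) q" for p q r
  proof -
    have "D.cosum (\<lambda>x y. D.cosum (\<lambda>u v. \<langle>x, p\<rangle> * \<langle>dual_mul y u, q\<rangle> * \<langle>v, r\<rangle>) dual_unit) dual_unit =
        D.cosum (\<lambda>x y. D.cosum (\<lambda>u v. cosum (\<lambda>m n. (\<langle>x, p\<rangle> * \<langle>y, m\<rangle>) * (\<langle>u, n\<rangle> * \<langle>v, r\<rangle>)) q) dual_unit) dual_unit"
      by (simp only: form_dual_mul cosum_mult mult.assoc)
    also have "\<dots> = cosum (\<lambda>x y. \<epsilon> (p \<odot> x) * \<epsilon> (y \<odot> r)) q"
      by (simp only: dual_cosum_swap D.cosum_mult[symmetric] dual_cosum_form form_dual_unit)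
    finally show ?thesis .
  qed
  have 2: "D.cosum (\<lambda>u v. D.cosum (\<lambda>x y. \<langle>x, p\<rangle> * \<langle>dual_mul u y, q\<rangle> * \<langle>v, r\<rangle>) dual_unit) dual_unit =
      cosum (\<lambda>x y. \<epsilon> (p \<odot> y) * \<epsilon> (x \<odot> r)) q" for p q r
  proof -
    have "D.cosum (\<lambda>u v. D.cosum (\<lambda>x y. \<langle>x, p\<rangle> * \<langle>dual_mul u y, q\<rangle> * \<langle>v, r\<rangle>) dual_unit) dual_unit =
        D.cosum (\<lambda>u v. D.cosum (\<lambda>x y. cosum (\<lambda>m n. (\<langle>x, p\<rangle> * \<langle>y, n\<rangle>) * (\<langle>u, m\<rangle> * \<langle>v, r\<rangle>)) q) dual_unit) dual_unit"
      by (simp only: form_dual_mul cosum_mult) (simp only: mult_ac)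
    also have "\<dots> = cosum (\<lambda>x y. \<epsilon> (p \<odot> y) * \<epsilon> (x \<odot> r)) q"
      by (simp only: dual_cosum_swap D.cosum_mult[symmetric] dual_cosum_form form_dual_unit)
    finally show ?thesis .
  qed
  show ?thesis
    unfolding D.comonoidal_iff_form monoidal_iff 0 1 2 by metis
qed

section \<open>The transpose of a pre-antipode\<close>

context
  fixes S
  assumes S: "lin scale scale S"
begin

lemma dual_map_linear: "lin scale scale (dual_map S)"
  by (rule linear_by_form; unfold form_dual_map[OF S]; intro multilinear)

text \<open>Pairing with \<open>w\<close> moves the transpose over to \<open>S w\<close>, and the
  product of functionals becomes the coproduct of \<open>S w\<close>.\<close>

lemma dual_anti_multiplicative_iff:
  "fin_dim_algebra.anti_multiplicative dual_mul (dual_map S) \<longleftrightarrow> anti_comultiplicative S"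
proof -
  interpret D: fin_dim_algebra scale dual_mul dual_unit
    by (rule dual_fin_dim_algebra)
  have "D.anti_multiplicative (dual_map S) \<longleftrightarrow>
      (\<forall>a b w. \<langle>dual_map S (dual_mul a b), w\<rangle> = \<langle>dual_mul (dual_map S b) (dual_map S a), w\<rangle>)"
    unfolding D.anti_multiplicative_def by (metis form_eqI)
  also have "\<dots> \<longleftrightarrow> (\<forall>a b w. cosum (\<lambda>x y. \<langle>x, a\<rangle> * \<langle>y, b\<rangle>) (S w) =
      cosum (\<lambda>x y. \<langle>S y, a\<rangle> * \<langle>S x, b\<rangle>) w)"
    by (simp only: form_dual_map[OF S] form_dual_mul) (simp only: form_commute mult.commute)
  also have "\<dots> \<longleftrightarrow> anti_comultiplicative S"
    unfolding anti_comultiplicative_iff_form[OF S] by blast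
  finally show ?thesis .
qed

text \<open>Pairing the coproduct of \<open>dual_unit\<close> with \<open>m\<close> and
  \<open>w\<close> gives \<open>\<epsilon> (m \<odot> w)\<close>, the coefficient in
  \<open>E w\<close>. Duality thus does not interchange \<open>E\<close> and
  \<open>F\<close>.\<close>

lemma dual_tcounit: "\<langle>weak_bialgebra.tcounit scale dual_mul dual_unit dual_comul dual_counit a, w\<rangle> = \<langle>a, E w\<rangle>"
proof -
  interpret D: weak_bialgebra scale dual_mul dual_unit dual_comul dual_counit
    by (rule dual_weak_bialgebra)
  have "\<langle>D.tcounit a, w\<rangle> = D.cosum (\<lambda>x y. dual_counit (dual_mul x a) * \<langle>y, w\<rangle>) dual_unit"
    by (rule D.tcounit_apply) (intro multilinear)
  also have "\<dots> = D.cosum (\<lambda>x y. cosum (\<lambda>m n. (\<langle>x, m\<rangle> * \<langle>y, w\<rangle>) * \<langle>a, n\<rangle>) \<one>) dual_unit"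
    by (simp only: dual_counit_def form_dual_mul cosum_mult) (simp only: mult_ac)
  also have "\<dots> = cosum (\<lambda>m n. \<epsilon> (m \<odot> w) * \<langle>a, n\<rangle>) \<one>"
    by (simp only: dual_cosum_swap D.cosum_mult[symmetric] dual_cosum_form form_dual_unit)
  also have "\<dots> = \<langle>a, E w\<rangle>"
    by (rule tcounit_apply[symmetric]) (intro multilinear)
  finally show ?thesis .
qed

lemma dual_scounit: "\<langle>weak_bialgebra.scounit scale dual_mul dual_unit dual_comul dual_counit a, w\<rangle> = \<langle>a, F w\<rangle>"
proof -
  interpret D: weak_bialgebra scale dual_mul dual_unit dual_comul dual_counit
    by (rule dual_weak_bialgebra)
  have "\<langle>D.scounit a, w\<rangle> = D.cosum (\<lambda>x y. dual_counit (dual_mul a y) * \<langle>x, w\<rangle>) dual_unit"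
    by (rule D.scounit_apply) (intro multilinear)
  also have "\<dots> = D.cosum (\<lambda>x y. cosum (\<lambda>m n. (\<langle>x, w\<rangle> * \<langle>y, n\<rangle>) * \<langle>a, m\<rangle>) \<one>) dual_unit"
    by (simp only: dual_counit_def form_dual_mul cosum_mult) (simp only: mult_ac)
  also have "\<dots> = cosum (\<lambda>m n. \<epsilon> (w \<odot> n) * \<langle>a, m\<rangle>) \<one>"
    by (simp only: dual_cosum_swap D.cosum_mult[symmetric] dual_cosum_form form_dual_unit)
  also have "\<dots> = \<langle>a, F w\<rangle>"
    by (rule scounit_apply[symmetric]) (intro multilinear)
  finally show ?thesis .
qed

text \<open>Convolution of \<open>S\<close> with the identity transposes to convolution in the same
  order, and \<open>E\<close> and \<open>F\<close> transpose to their own counterparts. Each of the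
  two laws therefore passes to itself.\<close>

lemma dual_pre_antipode_iff:
  "weak_bialgebra.pre_antipode scale dual_mul dual_unit dual_comul dual_counit (dual_map S) \<longleftrightarrow>
    pre_antipode S"
proof -
  interpret D: weak_bialgebra scale dual_mul dual_unit dual_comul dual_counit
    by (rule dual_weak_bialgebra)
  have f: "\<langle>D.cosum f a, w\<rangle> = D.cosum (\<lambda>x y. \<langle>f x y, w\<rangle>) a" for f a w
    by (rule D.linear_cosum[where s = scale and t = "(*)"]) (intro multilinear)
  have 1: "\<langle>D.cosum (\<lambda>x y. dual_mul x (dual_map S y)) a, w\<rangle> = \<langle>a, cosum (\<lambda>x y. x \<odot> S y) w\<rangle>"
    "\<langle>D.cosum (\<lambda>x y. dual_mul (dual_map S x) y) a, w\<rangle> = \<langle>a, cosum (\<lambda>x y. S x \<odot> y) w\<rangle>" for a w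
    by (simp_all only: f form_dual_mul form_dual_map[OF S] dual_cosum_swap dual_cosum_form form_cosum)
  have "D.pre_antipode (dual_map S) \<longleftrightarrow> (\<forall>a w.
      \<langle>D.cosum (\<lambda>x y. dual_mul x (dual_map S y)) a, w\<rangle> = \<langle>D.tcounit a, w\<rangle> \<and>
      \<langle>D.cosum (\<lambda>x y. dual_mul (dual_map S x) y) a, w\<rangle> = \<langle>D.scounit a, w\<rangle>)"
    unfolding D.pre_antipode_iff by (auto simp: dual_map_linear intro!: form_eqI)
  also have "\<dots> \<longleftrightarrow> pre_antipode S"
    unfolding pre_antipode_iff 1 dual_tcounit dual_scounit
    by (auto simp: S intro!: form_eqI')
  finally show ?thesis .
qed

lemma dual_antipode_iff:
  "weak_bialgebra.antipode scale dual_mul dual_unit dual_comul dual_counit (dual_map S) \<longleftrightarrow>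
    antipode S"
proof -
  interpret D: weak_bialgebra scale dual_mul dual_unit dual_comul dual_counit
    by (rule dual_weak_bialgebra)
  have f: "\<langle>D.cosum f a, w\<rangle> = D.cosum (\<lambda>x y. \<langle>f x y, w\<rangle>) a" for f a w
    by (rule D.linear_cosum[where s = scale and t = "(*)"]) (intro multilinear)
  have 1: "\<langle>D.cosum (\<lambda>x y. D.cosum (\<lambda>u v. dual_mul (dual_mul (dual_map S u) v) (dual_map S y)) x) a, w\<rangle> =
      \<langle>a, cosum (\<lambda>x y. cosum (\<lambda>u v. S u \<odot> v \<odot> S y) x) w\<rangle>" for a w
    by (simp only: f form_dual_mul form_dual_map[OF S] cosum_mult dual_cosum_swap)
      (simp only: D.cosum_mult[symmetric] dual_cosum_form form_cosum)
  have "(\<forall>a. D.cosum (\<lambda>x y. D.cosum (\<lambda>u v.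
        dual_mul (dual_mul (dual_map S u) v) (dual_map S y)) x) a = dual_map S a) \<longleftrightarrow>
      (\<forall>a w. \<langle>a, cosum (\<lambda>x y. cosum (\<lambda>u v. S u \<odot> v \<odot> S y) x) w\<rangle> = \<langle>a, S w\<rangle>)"
    unfolding 1[symmetric] form_dual_map[OF S, symmetric] by (metis form_eqI)
  also have "\<dots> \<longleftrightarrow> (\<forall>w. cosum (\<lambda>x y. cosum (\<lambda>u v. S u \<odot> v \<odot> S y) x) w = S w)"
    by (metis form_eqI')
  finally show ?thesis
    unfolding D.antipode_iff antipode_iff dual_pre_antipode_iff by blast
qed

end

section \<open>The two equivalences with the bimonoidal antipode condition\<close>

lemma comonoidal_anti_multiplicative_iff:
  assumes "pre_antipode S"
  shows "comonoidal \<and> anti_multiplicative S \<longleftrightarrow> bimonoidal \<and> antipode S"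
\<comment> \<open>Each side contains comonoidality, so the locale has to be entered in that case
  only.\<close>
proof (cases comonoidal)
  case True
  then interpret comonoidal_pre_antipode scale mul unit comul counit S
    by unfold_locales (use assms in auto)
  show ?thesis using True anti_multiplicative_iff by (auto simp: bimonoidal_def)
qed (simp add: bimonoidal_def)

text \<open>This is the preceding equivalence for the dual and \<open>dual_map S\<close>. Passing to
  the dual interchanges the monoidal and comonoidal conditions and keeps the bimonoidal and antipode
  conditions.\<close>

lemma monoidal_anti_comultiplicative_iff:
  assumes pre: "pre_antipode S"
  shows "monoidal \<and> anti_comultiplicative S \<longleftrightarrow> bimonoidal \<and> antipode S"
proof -
  interpret D: weak_bialgebra scale dual_mul dual_unit dual_comul dual_counit
    by (rule dual_weak_bialgebra)
  have S: "lin scale scale S" using pre by (simp add: pre_antipode_def)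
  from pre have "D.pre_antipode (dual_map S)" by (simp add: dual_pre_antipode_iff[OF S])
  from D.comonoidal_anti_multiplicative_iff[OF this] show ?thesis
    unfolding D.bimonoidal_def bimonoidal_def dual_comonoidal_iff dual_monoidal_iff
      dual_anti_multiplicative_iff[OF S] dual_antipode_iff[OF S] by blast
qed

end

theorem proposition8p3:
  fixes scale :: "'k::field \<Rightarrow> 'a::ab_group_add \<Rightarrow> 'a"
    and mul :: "'a \<Rightarrow> 'a \<Rightarrow> 'a"
    and unit :: 'a
    and comul :: "'a \<Rightarrow> ('k, 'a) tensor2"
    and counit :: "'a \<Rightarrow> 'k"
    and S :: "'a \<Rightarrow> 'a"
  assumes "weak_bialgebra scale mul unit comul counit"
    and "weak_bialgebra.pre_antipode scale mul unit comul counit S"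
  defines "cond_i \<equiv> weak_bialgebra.comonoidal scale mul unit comul \<and>
      fin_dim_algebra.anti_multiplicative mul S"
    and "cond_ii \<equiv> weak_bialgebra.monoidal scale mul comul counit \<and>
      coproduct_space.anti_comultiplicative scale comul S"
    and "cond_iii \<equiv> weak_bialgebra.bimonoidal scale mul unit comul counit \<and>
      weak_bialgebra.antipode scale mul unit comul counit S"
  shows "(cond_i \<longleftrightarrow> cond_ii) \<and> (cond_ii \<longleftrightarrow> cond_iii)"
proof -
  interpret weak_bialgebra scale mul unit comul counit by fact
  show ?thesis
    unfolding cond_i_def cond_ii_def cond_iii_def
    using comonoidal_anti_multiplicative_iff[OF assms(2)]
      monoidal_anti_comultiplicative_iff[OF assms(2)] by blast
qed

end
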